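(* For every integer $t\ge 2$ and all $\varepsilon,d_3>0$ there exists $\delta_3>0$ such that for every $d_2>0$ there exist $\delta_2>0$ and an integer $r\ge 1$ such that the following holds for all sufficiently large, pairwise disjoint finite sets $X$, $Y$, and $Z$. Let $H=(X\cup Y\cup Z,E_H)$ be a tripartite $3$-uniform hypergraph which is $(\delta_3,d_3,r)$-regular with respect to a $(\delta_2,d_2)$-triad $P=(X\cup Y\cup Z,E_P)$. Then all but at most $\varepsilon|X|^t$ of the $t$-tuples of vertices $X'=\{x_1,\dots,x_t\}\subseteq X$ satisfy $$\Big||L_H(X',P)|-d_3^{\,t}\,d_2^{\,2t+1}|Y||Z|\Big|\le \varepsilon\, d_3^{\,t}\,d_2^{\,2t+1}|Y||Z| .$$
   Context: **Regular bipartite graphs and triads.** A bipartite graph $G$ with classes $A,B$ is $(\delta,d)$-regular if $\big|e_G(A',B')-d|A'||B'|\big|\le\delta|A||B|$ for all $A'\subseteq A$, $B'\subseteq B$. A tripartite graph $P$ with vertex classes $X,Y,Z$ is a $(\delta,d)$-triad if each of the bipartite graphs $P[X,Y]$, $P[Y,Z]$, $P[X,Z]$ is $(\delta,d)$-regular. **Triangles.** $\mathcal K_3(G)$ is the set of $3$-subsets of $V(G)$ spanning a triangle in the graph $G$. **Regularity of a hypergraph with respect to a triad.** A tripartite $3$-uniform hypergraph $H=(X\cup Y\cup Z,E_H)$ (each hyperedge has exactly one vertex in each of $X,Y,Z$) is $(\delta,d,r)$-regular with respect to a tripartite graph $P$ with classes $X,Y,Z$ if $$\bigg|\Big|\bigcup_{i=1}^r\big(E_H\cap\mathcal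 K_3(Q_i)\big)\Big|-d\,\Big|\bigcup_{i=1}^r\mathcal K_3(Q_i)\Big|\bigg|\le\delta|\mathcal K_3(P)|$$ for every family of (not necessarily disjoint) subgraphs $Q_1,\dots,Q_r\subseteq P$ with $\big|\bigcup_{i=1}^r\mathcal K_3(Q_i)\big|\ge\delta|\mathcal K_3(P)|>0$. **Links and joint links supported on a graph.** For a vertex $v$ of a $3$-uniform hypergraph $H=(V,E)$, the link graph $L_H(v)$ has vertex set $V\setminus\{v\}$ and edge set $\{uw: uvw\in E\}$. For a graph $G$ with vertex set $V$, the link of $v$ supported on $G$ is $L_H(v,G)=E(L_H(v))\cap E(G)$. For $U\subseteq V$, the joint link supported on $G$ is $L_H(U,G)=\bigcap_{u\in U}L_H(u,G)$.
   Formalization: The hypothesis that every hyperedge of H spans a triangle of P (E_H ⊆ K_3(P)) is added; without it the claim fails, e.g. d_3=1, d_2=1/2, P a random triad and H the complete tripartite hypergraph, where L_H(X',P)=P[Y,Z]. *)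

theory Defs
  imports Complex_Main
begin

(* Graphs and 3-uniform hypergraphs are given by their edge sets (sets of 2-subsets,
   resp. 3-subsets, of the vertex set). A subgraph of P is a subset of its edges:
   isolated vertices affect neither triangles nor edge counts. *)

definition cross_pairs :: "'a set \<Rightarrow> 'a set \<Rightarrow> 'a set set" where
  "cross_pairs A B = {{a, b} | a b. a \<in> A \<and> b \<in> B}"

definition cross_triples :: "'a set \<Rightarrow> 'a set \<Rightarrow> 'a set \<Rightarrow> 'a set set" where
  "cross_triples X Y Z = {{x, y, z} | x y z. x \<in> X \<and> y \<in> Y \<and> z \<in> Z}"

(* G[A, B]; for disjoint A, B the number e_G(A, B) is its cardinality. *)
definition edges_between :: "'a set set \<Rightarrow> 'a set \<Rightarrow> 'a set \<Rightarrow> 'a set set" where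
  "edges_between G A B = G \<inter> cross_pairs A B"

definition bipartite_regular ::
    "real \<Rightarrow> real \<Rightarrow> 'a set \<Rightarrow> 'a set \<Rightarrow> 'a set set \<Rightarrow> bool" where
  "bipartite_regular \<delta> d A B G \<longleftrightarrow>
     G \<subseteq> cross_pairs A B \<and>
     (\<forall>A' B'. A' \<subseteq> A \<longrightarrow> B' \<subseteq> B \<longrightarrow>
       \<bar>real (card (edges_between G A' B')) - d * real (card A') * real (card B')\<bar>
         \<le> \<delta> * real (card A) * real (card B))"

definition tripartite_graph :: "'a set \<Rightarrow> 'a set \<Rightarrow> 'a set \<Rightarrow> 'a set set \<Rightarrow> bool" where
  "tripartite_graph X Y Z P \<longleftrightarrow>
     P \<subseteq> cross_pairs X Y \<union> cross_pairs Y Z \<union> cross_pairs X Z"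

definition triad ::
    "real \<Rightarrow> real \<Rightarrow> 'a set \<Rightarrow> 'a set \<Rightarrow> 'a set \<Rightarrow> 'a set set \<Rightarrow> bool" where
  "triad \<delta> d X Y Z P \<longleftrightarrow>
     tripartite_graph X Y Z P \<and>
     bipartite_regular \<delta> d X Y (edges_between P X Y) \<and>
     bipartite_regular \<delta> d Y Z (edges_between P Y Z) \<and>
     bipartite_regular \<delta> d X Z (edges_between P X Z)"

definition triangles :: "'a set set \<Rightarrow> 'a set set" where
  "triangles G = {T. card T = 3 \<and> (\<forall>u\<in>T. \<forall>v\<in>T. u \<noteq> v \<longrightarrow> {u, v} \<in> G)}"

definition tripartite_hypergraph ::
    "'a set \<Rightarrow> 'a set \<Rightarrow> 'a set \<Rightarrow> 'a set set \<Rightarrow> bool" where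
  "tripartite_hypergraph X Y Z H \<longleftrightarrow> H \<subseteq> cross_triples X Y Z"

(* This constrains H only on triangles of P; hyperedges outside (triangles P) are unrestricted,
   while they may still contribute to link_on H v P. Statements about links should therefore assume
   that P underlies H, i.e. H \<subseteq> triangles P. *)
definition hyper_regular ::
    "real \<Rightarrow> real \<Rightarrow> nat \<Rightarrow> 'a set set \<Rightarrow> 'a set set \<Rightarrow> bool" where
  "hyper_regular \<delta> d r H P \<longleftrightarrow>
     (\<forall>Q :: nat \<Rightarrow> 'a set set.
        (\<forall>i\<in>{1..r}. Q i \<subseteq> P) \<longrightarrow>
        real (card (\<Union>i\<in>{1..r}. triangles (Q i))) \<ge> \<delta> * real (card (triangles P)) \<longrightarrow>
        \<delta> * real (card (triangles P)) > 0 \<longrightarrow>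
        \<bar>real (card (\<Union>i\<in>{1..r}. H \<inter> triangles (Q i)))
           - d * real (card (\<Union>i\<in>{1..r}. triangles (Q i)))\<bar>
          \<le> \<delta> * real (card (triangles P)))"

(* In a 3-uniform H, {u, v, w} in H forces u, v, w to be distinct. *)
definition link_edges :: "'a set set \<Rightarrow> 'a \<Rightarrow> 'a set set" where
  "link_edges H v = {{u, w} | u w. {u, v, w} \<in> H}"

definition link_on :: "'a set set \<Rightarrow> 'a \<Rightarrow> 'a set set \<Rightarrow> 'a set set" where
  "link_on H v G = link_edges H v \<inter> G"

definition joint_link_on :: "'a set set \<Rightarrow> 'a set \<Rightarrow> 'a set set \<Rightarrow> 'a set set" where
  "joint_link_on H U G = (\<Inter>u\<in>U. link_on H u G)"

end

(* Regard H as a bipartite graph g between X and the edges of P[Y, Z], inside the bipartite graph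
   nu of triangles of P. Regularity of P makes nu quasirandom of density p = d2^2 with error far
   below any power of p, while (delta3, d3, 1)-regularity of H makes g - d3 nu small in cut norm
   relative to p; so r = 1 and n0 = 1 suffice. For t vertices of X the joint link is the common
   neighbourhood in g. One replaces the factors g by d3 nu and then nu by p one at a time in L^1 over
   all t-tuples: the other factors, though sparse, are removed by Cauchy-Schwarz and the
   quasirandomness of nu, after which the cut norm bound applies. Markov's inequality concludes. *)

theory Submission
  imports Defs
begin

text \<open>The obstacle is the order of the quantifiers. \<open>\<delta>3\<close> is fixed before
  \<open>d2\<close>, so the cut norm of \<open>g - d3 * \<nu>\<close> is only a small multiple of
  \<open>p\<close>, whereas the counts have order \<open>p ^ t\<close>; bounding the other
  \<open>t - 1\<close> factors by 1 would lose \<open>p ^ (t - 1)\<close>. In contrast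
  \<open>\<delta>2\<close> is fixed after \<open>d2\<close>, so an error of \<open>\<nu>\<close> may
  lose any power of \<open>p\<close>. Hence two kinds of estimate. Where \<open>\<nu> - p\<close>
  occurs, all other factors are bounded crudely by 1. Where \<open>g - d3 * \<nu>\<close> occurs,
  the other factors \<open>g\<close> are majorised by the product \<open>V\<close> of the
  corresponding \<open>\<nu>\<close>, whose total mass still carries the power of \<open>p\<close>.
  Cauchy-Schwarz then leaves a second moment weighted by \<open>V\<close>, and there
  \<open>V\<close> may be exchanged for its mean at the expense of \<open>\<nu>\<close> alone. What
  remains is a second moment without tuples, in which a smallness condition on
  \<open>\<delta>3\<close> free of \<open>p\<close> is enough.\<close>

section \<open>Sums over tuples\<close>

definition tuples :: "'a set \<Rightarrow> nat \<Rightarrow> 'a list set" where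
  "tuples X t = {xs. length xs = t \<and> set xs \<subseteq> X}"

lemma tuples_0 [simp]: "tuples X 0 = {[]}"
  by (auto simp: tuples_def)

lemma finite_tuples [simp]: "finite X \<Longrightarrow> finite (tuples X t)"
  using finite_lists_length_eq[of X t] by (simp add: tuples_def conj_commute)

lemma card_tuples: "finite X \<Longrightarrow> card (tuples X t) = card X ^ t"
  using card_lists_length_eq[of X t] by (simp add: tuples_def conj_commute)

lemma sum_tuples_Suc:
  "(\<Sum>xs\<in>tuples X (Suc t). f xs) = (\<Sum>xs\<in>tuples X t. \<Sum>x\<in>X. f (x # xs))"
proof -
  have "tuples X (Suc t) = (\<lambda>(xs, x). x # xs) ` (tuples X t \<times> X)"
    by (force simp: tuples_def length_Suc_conv image_iff)
  moreover have "inj_on (\<lambda>(xs, x). x # xs) (tuples X t \<times> X)"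
    by (auto simp: inj_on_def)
  ultimately show ?thesis
    by (simp add: sum.reindex sum.cartesian_product case_prod_unfold)
qed

section \<open>The cut norm and bounded weights\<close>

text \<open>A linear function on the cube \<open>[0,1]^W\<close> is largest at a vertex, namely at
  the indicator of the positive coefficients.\<close>

lemma sum_mult_le_subset_sum:
  fixes c u :: "'b \<Rightarrow> real"
  assumes "finite W" "\<And>w. w \<in> W \<Longrightarrow> 0 \<le> u w \<and> u w \<le> 1"
  shows "\<exists>W'\<subseteq>W. (\<Sum>w\<in>W. c w * u w) \<le> (\<Sum>w\<in>W'. c w)"
proof (intro exI conjI)
  let ?W = "{w \<in> W. c w > 0}"
  show "?W \<subseteq> W" by auto
  have "(\<Sum>w\<in>W. c w * u w) \<le> (\<Sum>w\<in>W. if c w > 0 then c w else 0)"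
    using assms(2) by (intro sum_mono) (auto simp: mult_left_le mult_nonpos_nonneg)
  also have "\<dots> = (\<Sum>w\<in>?W. c w)"
    using assms(1) by (simp add: sum.inter_filter)
  finally show "(\<Sum>w\<in>W. c w * u w) \<le> (\<Sum>w\<in>?W. c w)" .
qed

lemma sum_abs_le_subset_sums:
  fixes c :: "'b \<Rightarrow> real"
  assumes "finite X" "\<And>X'. X' \<subseteq> X \<Longrightarrow> \<bar>\<Sum>x\<in>X'. c x\<bar> \<le> b"
  shows "(\<Sum>x\<in>X. \<bar>c x\<bar>) \<le> 2 * b"
proof -
  have "(\<Sum>x\<in>X. \<bar>c x\<bar>) = (\<Sum>x\<in>X. (if c x > 0 then c x else 0) - (if c x \<le> 0 then c x else 0))"
    by (intro sum.cong) auto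
  also have "\<dots> = (\<Sum>x\<in>{x\<in>X. c x > 0}. c x) - (\<Sum>x\<in>{x\<in>X. c x \<le> 0}. c x)"
    using assms(1) by (simp add: sum_subtractf sum.inter_filter)
  also have "\<dots> \<le> 2 * b"
    using assms(2)[of "{x\<in>X. c x > 0}"] assms(2)[of "{x\<in>X. c x \<le> 0}"] by auto
  finally show ?thesis .
qed

text \<open>The unnormalised cut norm of the matrix \<open>F\<close>. The bound \<open>b\<close> is
  absolute, so that errors on different scales, such as \<open>\<kappa>\<close> and
  \<open>\<delta> * p\<close>, fit the same notion.\<close>

definition cut_bounded :: "'a set \<Rightarrow> 'b set \<Rightarrow> ('a \<Rightarrow> 'b \<Rightarrow> real) \<Rightarrow> real \<Rightarrow> bool" where
  "cut_bounded X W F b \<longleftrightarrow>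
     (\<forall>X' W'. X' \<subseteq> X \<longrightarrow> W' \<subseteq> W \<longrightarrow> \<bar>\<Sum>x\<in>X'. \<Sum>w\<in>W'. F x w\<bar> \<le> b)"

lemma cut_boundedD:
  "cut_bounded X W F b \<Longrightarrow> X' \<subseteq> X \<Longrightarrow> W' \<subseteq> W \<Longrightarrow> \<bar>\<Sum>x\<in>X'. \<Sum>w\<in>W'. F x w\<bar> \<le> b"
  by (simp add: cut_bounded_def)

lemma cut_bounded_nonneg: "cut_bounded X W F b \<Longrightarrow> 0 \<le> b"
  using cut_boundedD[of X W F b "{}" "{}"] by simp

lemma cut_bounded_mono:
  assumes "cut_bounded X W F b" "b \<le> b'"
  shows "cut_bounded X W F b'"
  unfolding cut_bounded_def
proof (intro allI impI)
  fix X' W' assume "X' \<subseteq> X" "W' \<subseteq> W"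
  from cut_boundedD[OF assms(1) this] assms(2)
  show "\<bar>\<Sum>x\<in>X'. \<Sum>w\<in>W'. F x w\<bar> \<le> b'" by linarith
qed

lemma cut_bounded_swap:
  assumes "cut_bounded X W F b"
  shows "cut_bounded W X (\<lambda>w x. F x w) b"
  unfolding cut_bounded_def
proof (intro allI impI)
  fix W' X' assume "W' \<subseteq> W" "X' \<subseteq> X"
  from cut_boundedD[OF assms this(2,1)]
  show "\<bar>\<Sum>w\<in>W'. \<Sum>x\<in>X'. F x w\<bar> \<le> b"
    by (simp only: sum.swap[of "\<lambda>w x. F x w"])
qed

text \<open>For fixed \<open>X'\<close> the sum is linear in \<open>u\<close>, so its maximum is
  attained at the indicator of a subset of \<open>W\<close>; the lower bound is the same argument
  for \<open>- F\<close>.\<close>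

lemma cut_bounded_weight01:
  assumes cut: "cut_bounded X W F b" and fin: "finite W"
    and u: "\<And>w. w \<in> W \<Longrightarrow> 0 \<le> u w \<and> u w \<le> 1" and "X' \<subseteq> X"
  shows "\<bar>\<Sum>x\<in>X'. \<Sum>w\<in>W. F x w * u w\<bar> \<le> b"
proof -
  have *: "(\<Sum>x\<in>X'. \<Sum>w\<in>W. G x w * u w) \<le> b"
    if "cut_bounded X W G b" for G :: "'a \<Rightarrow> 'b \<Rightarrow> real"
  proof -
    have "(\<Sum>x\<in>X'. \<Sum>w\<in>W. G x w * u w) = (\<Sum>w\<in>W. (\<Sum>x\<in>X'. G x w) * u w)"
      by (subst sum.swap) (simp add: sum_distrib_right)
    moreover obtain W' where "W' \<subseteq> W"
      "(\<Sum>w\<in>W. (\<Sum>x\<in>X'. G x w) * u w) \<le> (\<Sum>w\<in>W'. \<Sum>x\<in>X'. G x w)"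
      using sum_mult_le_subset_sum[OF fin u, of "\<lambda>w. w" "\<lambda>w. \<Sum>x\<in>X'. G x w"] by auto
    moreover have "\<bar>\<Sum>w\<in>W'. \<Sum>x\<in>X'. G x w\<bar> \<le> b"
      by (rule cut_boundedD[OF cut_bounded_swap[OF that] \<open>W' \<subseteq> W\<close> \<open>X' \<subseteq> X\<close>])
    ultimately show ?thesis by linarith
  qed
  have "cut_bounded X W (\<lambda>x w. - F x w) b"
    using cut unfolding cut_bounded_def by (simp only: sum_negf abs_minus_cancel)
  from *[OF this] *[OF cut] show ?thesis by (simp add: sum_negf)
qed

text \<open>Up to a constant, the cut norm controls the operator norm from L^infinity to L^1. The
  constant 4 is a factor 2 for the sign of \<open>u\<close> times a factor 2 for the sign of the row
  sums.\<close>

lemma cut_bounded_weight: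
  assumes cut: "cut_bounded X W F b" and fin: "finite X" "finite W" and "B > 0"
    and u: "\<And>w. w \<in> W \<Longrightarrow> \<bar>u w\<bar> \<le> B"
  shows "(\<Sum>x\<in>X. \<bar>\<Sum>w\<in>W. F x w * u w\<bar>) \<le> 4 * b * B"
proof -
  define v1 where "v1 = (\<lambda>w. max (u w) 0 / B)"
  define v2 where "v2 = (\<lambda>w. max (- u w) 0 / B)"
  have v: "0 \<le> v1 w \<and> v1 w \<le> 1" "0 \<le> v2 w \<and> v2 w \<le> 1" if "w \<in> W" for w
    using u[OF that] \<open>B > 0\<close> by (auto simp: v1_def v2_def)
  have u_eq: "u w = B * (v1 w - v2 w)" for w
    using \<open>B > 0\<close> by (simp add: v1_def v2_def field_simps max_def)
  have eq: "(\<Sum>w\<in>W. F x w * u w) = B * ((\<Sum>w\<in>W. F x w * v1 w) - (\<Sum>w\<in>W. F x w * v2 w))" for x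
    unfolding sum_subtractf[symmetric] sum_distrib_left
    by (intro sum.cong refl) (simp only: u_eq right_diff_distrib mult.left_commute)
  have "(\<Sum>x\<in>X. \<bar>\<Sum>w\<in>W. F x w * u w\<bar>) \<le> 2 * (2 * b * B)"
  proof (rule sum_abs_le_subset_sums[OF fin(1)])
    fix X' assume "X' \<subseteq> X"
    have "(\<Sum>x\<in>X'. \<Sum>w\<in>W. F x w * u w)
        = B * ((\<Sum>x\<in>X'. \<Sum>w\<in>W. F x w * v1 w) - (\<Sum>x\<in>X'. \<Sum>w\<in>W. F x w * v2 w))"
      unfolding eq by (simp only: sum_subtractf[symmetric] sum_distrib_left)
    also have "\<bar>\<dots>\<bar> \<le> B * (b + b)"
    proof -
      have "\<bar>\<Sum>x\<in>X'. \<Sum>w\<in>W. F x w * v1 w\<bar> \<le> b"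
        by (rule cut_bounded_weight01[OF cut fin(2) v(1) \<open>X' \<subseteq> X\<close>])
      moreover have "\<bar>\<Sum>x\<in>X'. \<Sum>w\<in>W. F x w * v2 w\<bar> \<le> b"
        by (rule cut_bounded_weight01[OF cut fin(2) v(2) \<open>X' \<subseteq> X\<close>])
      ultimately show ?thesis
        using \<open>B > 0\<close> unfolding abs_mult by (intro mult_mono) auto
    qed
    finally show "\<bar>\<Sum>x\<in>X'. \<Sum>w\<in>W. F x w * u w\<bar> \<le> 2 * b * B"
      by (simp add: algebra_simps)
  qed
  then show ?thesis by simp
qed

section \<open>Counting in a sparse weight \<open>g\<close> below a quasirandom weight
  \<open>\<nu>\<close>\<close>

text \<open>The two errors are scaled differently on purpose: \<open>\<delta>\<close> is relative to
  \<open>p\<close> because it must be chosen before \<open>p\<close>, while \<open>\<kappa>\<close>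
  is absolute because it may depend on \<open>p\<close>.\<close>

locale relative_bigraph =
  fixes X :: "'a set" and W :: "'b set" and \<nu> g :: "'a \<Rightarrow> 'b \<Rightarrow> real"
    and p d \<kappa> \<delta> :: real
  assumes fin: "finite X" "finite W" and X_nonempty: "X \<noteq> {}"
    and p_pos: "p > 0" and d_pos: "d > 0"
    and g_bounds: "\<And>x w. x \<in> X \<Longrightarrow> w \<in> W \<Longrightarrow> 0 \<le> g x w \<and> g x w \<le> \<nu> x w"
    and \<nu>_le_1: "\<And>x w. x \<in> X \<Longrightarrow> w \<in> W \<Longrightarrow> \<nu> x w \<le> 1"
    and cut_\<nu>: "cut_bounded X W (\<lambda>x w. \<nu> x w - p) (\<kappa> * card X * card W)"
    and cut_g: "cut_bounded X W (\<lambda>x w. g x w - d * \<nu> x w) (\<delta> * p * card X * card W)"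
begin

abbreviation "n \<equiv> real (card X)"
abbreviation "m \<equiv> real (card W)"
abbreviation "V xs w \<equiv> prod_list (map (\<lambda>x. \<nu> x w) xs)"
abbreviation "U xs w \<equiv> prod_list (map (\<lambda>x. g x w) xs)"
abbreviation "G x w \<equiv> g x w - d * \<nu> x w"

lemma n_pos: "n > 0"
  using fin X_nonempty by (simp add: card_gt_0_iff)

lemma U_V_bounds:
  assumes "set xs \<subseteq> X" "w \<in> W"
  shows "0 \<le> U xs w \<and> U xs w \<le> V xs w \<and> V xs w \<le> 1"
  using assms
proof (induction xs)
  case (Cons x xs)
  then have IH: "0 \<le> U xs w" "U xs w \<le> V xs w" "V xs w \<le> 1" and "x \<in> X" by auto
  note x = g_bounds[OF \<open>x \<in> X\<close> \<open>w \<in> W\<close>] \<nu>_le_1[OF \<open>x \<in> X\<close> \<open>w \<in> W\<close>]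
  have "g x w * U xs w \<le> \<nu> x w * V xs w"
    using IH x by (intro mult_mono) auto
  moreover have "\<nu> x w * V xs w \<le> 1"
    using IH x by (intro mult_le_one) auto
  ultimately show ?case using IH x by simp
qed auto

text \<open>Stated for the product because an empty \<open>W\<close> leaves the sign of
  \<open>\<kappa>\<close> open.\<close>

lemma \<kappa>_nonneg: "\<kappa> * n * m \<ge> 0"
  using cut_bounded_nonneg[OF cut_\<nu>] .

lemma G_bound:
  assumes "x \<in> X" "w \<in> W"
  shows "\<bar>G x w\<bar> \<le> (1 + d) * \<nu> x w" "\<bar>G x w\<bar> \<le> 1 + d"
proof -
  have "0 \<le> d * \<nu> x w" using g_bounds[OF assms] d_pos by simp
  then show *: "\<bar>G x w\<bar> \<le> (1 + d) * \<nu> x w"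
    using g_bounds[OF assms] by (auto simp: abs_le_iff algebra_simps)
  have "(1 + d) * \<nu> x w \<le> (1 + d) * 1"
    using \<nu>_le_1[OF assms] d_pos by (intro mult_left_mono) auto
  with * show "\<bar>G x w\<bar> \<le> 1 + d" by simp
qed

text \<open>Telescoping with \<open>\<nu> x * V - p ^ Suc t = (\<nu> x - p) * V + p * (V - p ^
  t)\<close>. In the first term \<open>V * u\<close> is itself a weight bounded by \<open>B\<close>,
  so the cut bound for \<open>\<nu>\<close> applies. The weight \<open>u\<close> has to be the same
  for all tuples, because it is carried through the induction.\<close>

lemma V_deviation:
  assumes "B > 0" and u: "\<And>w. w \<in> W \<Longrightarrow> \<bar>u w\<bar> \<le> B"
  shows "(\<Sum>xs\<in>tuples X t. \<bar>\<Sum>w\<in>W. (V xs w - p ^ t) * u w\<bar>)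
           \<le> (1 + p) ^ t * (4 * \<kappa> * n ^ t * m * B)"
proof (induction t)
  case 0
  have "0 \<le> n * (\<kappa> * m)" using \<kappa>_nonneg by (simp add: mult_ac)
  then have "0 \<le> \<kappa> * m" using n_pos by (simp only: zero_le_mult_iff) auto
  then show ?case using \<open>B > 0\<close> by (simp add: mult.assoc)
next
  case (Suc t)
  let ?S = "\<lambda>xs. \<bar>\<Sum>w\<in>W. (V xs w - p ^ t) * u w\<bar>"
  have step: "(\<Sum>x\<in>X. \<bar>\<Sum>w\<in>W. (V (x # xs) w - p ^ Suc t) * u w\<bar>)
      \<le> 4 * (\<kappa> * n * m) * B + n * p * ?S xs" if xs: "xs \<in> tuples X t" for xs
  proof -
    have "\<bar>\<Sum>w\<in>W. (V (x # xs) w - p ^ Suc t) * u w\<bar>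
        \<le> \<bar>\<Sum>w\<in>W. (\<nu> x w - p) * (V xs w * u w)\<bar> + p * ?S xs" for x
    proof -
      have "(\<Sum>w\<in>W. (V (x # xs) w - p ^ Suc t) * u w)
          = (\<Sum>w\<in>W. (\<nu> x w - p) * (V xs w * u w)) + p * (\<Sum>w\<in>W. (V xs w - p ^ t) * u w)"
        by (simp add: sum_distrib_left sum.distrib[symmetric] algebra_simps)
      then have "\<bar>\<Sum>w\<in>W. (V (x # xs) w - p ^ Suc t) * u w\<bar>
          \<le> \<bar>\<Sum>w\<in>W. (\<nu> x w - p) * (V xs w * u w)\<bar> + \<bar>p * (\<Sum>w\<in>W. (V xs w - p ^ t) * u w)\<bar>"
        by (simp only: abs_triangle_ineq)
      then show ?thesis using p_pos by (simp only: abs_mult abs_of_pos)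
    qed
    then have "(\<Sum>x\<in>X. \<bar>\<Sum>w\<in>W. (V (x # xs) w - p ^ Suc t) * u w\<bar>)
        \<le> (\<Sum>x\<in>X. \<bar>\<Sum>w\<in>W. (\<nu> x w - p) * (V xs w * u w)\<bar> + p * ?S xs)"
      by (rule sum_mono)
    also have "\<dots> = (\<Sum>x\<in>X. \<bar>\<Sum>w\<in>W. (\<nu> x w - p) * (V xs w * u w)\<bar>) + n * p * ?S xs"
      by (simp add: sum.distrib)
    also have "(\<Sum>x\<in>X. \<bar>\<Sum>w\<in>W. (\<nu> x w - p) * (V xs w * u w)\<bar>) \<le> 4 * (\<kappa> * n * m) * B"
    proof (rule cut_bounded_weight[OF cut_\<nu> fin \<open>B > 0\<close>])
      fix w assume "w \<in> W"
      have "0 \<le> V xs w" "V xs w \<le> 1"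
        using U_V_bounds[of xs w] xs \<open>w \<in> W\<close> by (auto simp: tuples_def)
      then have "\<bar>V xs w\<bar> * \<bar>u w\<bar> \<le> 1 * B"
        using u[OF \<open>w \<in> W\<close>] by (intro mult_mono) auto
      then show "\<bar>V xs w * u w\<bar> \<le> B" by (simp add: abs_mult)
    qed
    finally show ?thesis by simp
  qed
  have "(\<Sum>xs\<in>tuples X (Suc t). \<bar>\<Sum>w\<in>W. (V xs w - p ^ Suc t) * u w\<bar>)
      \<le> (\<Sum>xs\<in>tuples X t. 4 * (\<kappa> * n * m) * B + n * p * ?S xs)"
    unfolding sum_tuples_Suc by (rule sum_mono[OF step])
  also have "\<dots> = n ^ t * (4 * (\<kappa> * n * m) * B) + n * p * (\<Sum>xs\<in>tuples X t. ?S xs)"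
    using fin by (simp add: sum.distrib card_tuples sum_distrib_left)
  also have "\<dots> \<le> n ^ t * (4 * (\<kappa> * n * m) * B)
      + n * p * ((1 + p) ^ t * (4 * \<kappa> * n ^ t * m * B))"
    using Suc.IH p_pos by (intro add_left_mono mult_left_mono) auto
  also have "\<dots> = (1 + p * (1 + p) ^ t) * (n ^ t * (4 * (\<kappa> * n * m) * B))"
    by (simp add: algebra_simps)
  \<comment> \<open>The recursion \<open>a (t + 1) = 1 + p * a t\<close> is majorised by
    \<open>(1 + p) ^ t\<close>, a closed form that is good enough because \<open>\<kappa>\<close> is
    chosen after \<open>p\<close>.\<close>
  also have "\<dots> \<le> ((1 + p) ^ t + p * (1 + p) ^ t) * (n ^ t * (4 * (\<kappa> * n * m) * B))"
    using \<kappa>_nonneg \<open>B > 0\<close> p_pos by (intro mult_right_mono) auto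
  also have "\<dots> = (1 + p) ^ Suc t * (4 * \<kappa> * n ^ Suc t * m * B)"
    by (simp add: algebra_simps)
  finally show ?case .
qed

text \<open>The case \<open>u = 1\<close> of \<open>V_deviation\<close>. It provides the total mass
  in the Cauchy-Schwarz step, and with it the factor \<open>p ^ t\<close> that bounding by 1 would
  lose.\<close>

lemma sum_V_le:
  "(\<Sum>xs\<in>tuples X t. \<Sum>w\<in>W. V xs w) \<le> (p ^ t + (1 + p) ^ t * (4 * \<kappa>)) * (n ^ t * m)"
proof -
  have "(\<Sum>xs\<in>tuples X t. \<Sum>w\<in>W. V xs w)
      = (\<Sum>xs\<in>tuples X t. p ^ t * m) + (\<Sum>xs\<in>tuples X t. \<Sum>w\<in>W. (V xs w - p ^ t) * 1)"
    unfolding sum.distrib[symmetric] by (simp add: sum_subtractf)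
  also have "(\<Sum>xs\<in>tuples X t. \<Sum>w\<in>W. (V xs w - p ^ t) * 1)
      \<le> (\<Sum>xs\<in>tuples X t. \<bar>\<Sum>w\<in>W. (V xs w - p ^ t) * 1\<bar>)"
    by (intro sum_mono) simp
  also have "\<dots> \<le> (1 + p) ^ t * (4 * \<kappa> * n ^ t * m * 1)"
    by (rule V_deviation) auto
  finally show ?thesis using fin by (simp add: card_tuples algebra_simps)
qed

lemma degree_deviation: "(\<Sum>w\<in>W. \<bar>(\<Sum>x\<in>X. \<nu> x w) - p * n\<bar>) \<le> 4 * \<kappa> * n * m"
proof -
  have "(\<Sum>w\<in>W. \<bar>\<Sum>x\<in>X. (\<nu> x w - p) * 1\<bar>) \<le> 4 * (\<kappa> * n * m) * 1"
    using fin by (intro cut_bounded_weight[OF cut_bounded_swap[OF cut_\<nu>]]) auto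
  then show ?thesis by (simp add: sum_subtractf algebra_simps)
qed

text \<open>The cut bound controls the \<open>L\<^sup>1\<close> norm of the signed degrees of \<open>G\<close>; the trivial bound
  by degrees in \<open>\<nu>\<close>, which are almost constant, upgrades this to \<open>L\<^sup>2\<close> at the right scale.\<close>

lemma sum_signed_degree_sq:
  assumes s: "\<And>x. x \<in> X \<Longrightarrow> \<bar>s x\<bar> \<le> 1"
  shows "(\<Sum>w\<in>W. (\<Sum>x\<in>X. s x * G x w)\<^sup>2)
           \<le> (4 * (1 + d) * \<delta> * p\<^sup>2 + 4 * (1 + d)\<^sup>2 * \<kappa>) * (n\<^sup>2 * m)"
proof -
  let ?A = "\<lambda>w. \<Sum>x\<in>X. s x * G x w"
  let ?D = "\<lambda>w. \<Sum>x\<in>X. \<nu> x w"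
  have A1: "(\<Sum>w\<in>W. \<bar>?A w\<bar>) \<le> 4 * (\<delta> * p * n * m) * 1"
    using cut_bounded_weight[OF cut_bounded_swap[OF cut_g], of 1 s] fin s by (simp add: mult.commute)
  have sG: "\<bar>s x * G x w\<bar> \<le> \<bar>G x w\<bar>" if "x \<in> X" for x w
    using s[OF that] by (simp add: abs_mult mult_left_le_one_le)
  have AD: "\<bar>?A w\<bar> \<le> (1 + d) * ?D w" if "w \<in> W" for w
  proof -
    have "\<bar>?A w\<bar> \<le> (\<Sum>x\<in>X. (1 + d) * \<nu> x w)"
      using sG G_bound(1)[OF _ that] by (intro order.trans[OF sum_abs] sum_mono) (meson order_trans)
    then show ?thesis by (simp add: sum_distrib_left)
  qed
  have An: "\<bar>?A w\<bar> \<le> (1 + d) * n" if "w \<in> W" for w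
  proof -
    have "\<bar>?A w\<bar> \<le> (\<Sum>x\<in>X. 1 + d)"
      using sG G_bound(2)[OF _ that] by (intro order.trans[OF sum_abs] sum_mono) (meson order_trans)
    then show ?thesis by (simp add: mult.commute)
  qed
  \<comment> \<open>One factor of the square is bounded by the degree, split into
    \<open>p * n\<close> and its deviation. The main part multiplies an \<open>L^1\<close> norm of
    order \<open>\<delta> * p * n * m\<close>, which gives the second power of \<open>p\<close>; the
    deviation costs \<open>\<kappa>\<close>, so there the other factor needs no
    \<open>p\<close>.\<close>
  have pt: "(?A w)\<^sup>2 \<le> (1 + d) * (p * n) * \<bar>?A w\<bar> + (1 + d)\<^sup>2 * n * \<bar>?D w - p * n\<bar>"
    if "w \<in> W" for w
  proof -
    have "(?A w)\<^sup>2 = \<bar>?A w\<bar> * \<bar>?A w\<bar>" by (simp add: power2_eq_square)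
    also have "\<dots> \<le> ((1 + d) * ?D w) * \<bar>?A w\<bar>"
      using AD[OF that] by (rule mult_right_mono) simp
    also have "\<dots> = (1 + d) * (p * n) * \<bar>?A w\<bar> + (1 + d) * ((?D w - p * n) * \<bar>?A w\<bar>)"
      by (simp add: algebra_simps)
    also have "\<dots> \<le> (1 + d) * (p * n) * \<bar>?A w\<bar> + (1 + d) * (\<bar>?D w - p * n\<bar> * ((1 + d) * n))"
      using An[OF that] d_pos by (intro add_left_mono mult_left_mono mult_mono) auto
    also have "(1 + d) * (\<bar>?D w - p * n\<bar> * ((1 + d) * n)) = (1 + d)\<^sup>2 * n * \<bar>?D w - p * n\<bar>"
      by (simp only: power2_eq_square mult_ac)
    finally show ?thesis .
  qed
  have "(\<Sum>w\<in>W. (?A w)\<^sup>2) \<le> (1 + d) * (p * n) * (\<Sum>w\<in>W. \<bar>?A w\<bar>)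
      + (1 + d)\<^sup>2 * n * (\<Sum>w\<in>W. \<bar>?D w - p * n\<bar>)"
    unfolding sum_distrib_left sum.distrib[symmetric] by (rule sum_mono[OF pt])
  also have "\<dots> \<le> (1 + d) * (p * n) * (4 * (\<delta> * p * n * m) * 1)
      + (1 + d)\<^sup>2 * n * (4 * \<kappa> * n * m)"
    using A1 degree_deviation d_pos p_pos by (intro add_mono mult_left_mono) auto
  also have "\<dots> = (4 * (1 + d) * \<delta> * p\<^sup>2 + 4 * (1 + d)\<^sup>2 * \<kappa>) * (n\<^sup>2 * m)"
    by (simp add: algebra_simps power2_eq_square)
  finally show ?thesis .
qed

text \<open>Exchanging \<open>V xs\<close> for \<open>p ^ t\<close> reduces this to
  \<open>sum_signed_degree_sq\<close>. The signs depend on \<open>xs\<close>, so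
  \<open>V_deviation\<close> does not apply to the square itself. Expanding the square separates
  them from the weight \<open>G x w * G y w\<close>, which is the same for all tuples; the signs are
  then dropped pair by pair.\<close>

lemma sum_V_signed_degree_sq:
  assumes s: "\<And>xs x. xs \<in> tuples X t \<Longrightarrow> x \<in> X \<Longrightarrow> \<bar>s xs x\<bar> \<le> 1"
  shows "(\<Sum>xs\<in>tuples X t. \<Sum>w\<in>W. V xs w * (\<Sum>x\<in>X. s xs x * G x w)\<^sup>2)
           \<le> (p ^ t * (4 * (1 + d) * \<delta> * p\<^sup>2 + 4 * (1 + d)\<^sup>2 * \<kappa>)
               + (1 + p) ^ t * (4 * \<kappa> * (1 + d)\<^sup>2)) * (n ^ t * n\<^sup>2 * m)"
proof -
  let ?A = "\<lambda>xs w. \<Sum>x\<in>X. s xs x * G x w"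
  let ?c = "(1 + d)\<^sup>2"
  let ?E = "\<lambda>xs x y. \<Sum>w\<in>W. (V xs w - p ^ t) * (G x w * G y w)"
  let ?K = "4 * (1 + d) * \<delta> * p\<^sup>2 + 4 * (1 + d)\<^sup>2 * \<kappa>"
  have dev: "(\<Sum>w\<in>W. (V xs w - p ^ t) * (?A xs w)\<^sup>2) \<le> (\<Sum>x\<in>X. \<Sum>y\<in>X. \<bar>?E xs x y\<bar>)"
    if xs: "xs \<in> tuples X t" for xs
  proof -
    have "(\<Sum>w\<in>W. (V xs w - p ^ t) * (?A xs w)\<^sup>2)
        = (\<Sum>w\<in>W. \<Sum>x\<in>X. \<Sum>y\<in>X. s xs x * s xs y * ((V xs w - p ^ t) * (G x w * G y w)))"
    proof (rule sum.cong[OF refl])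
      fix w
      have "(?A xs w)\<^sup>2 = (\<Sum>x\<in>X. \<Sum>y\<in>X. s xs x * s xs y * (G x w * G y w))"
        by (simp add: power2_eq_square sum_product mult_ac)
      then show "(V xs w - p ^ t) * (?A xs w)\<^sup>2
          = (\<Sum>x\<in>X. \<Sum>y\<in>X. s xs x * s xs y * ((V xs w - p ^ t) * (G x w * G y w)))"
        by (simp add: sum_distrib_left mult.left_commute)
    qed
    also have "\<dots> = (\<Sum>x\<in>X. \<Sum>y\<in>X. s xs x * s xs y * ?E xs x y)"
      unfolding sum_distrib_left
      by (subst sum.swap, intro sum.cong refl, subst sum.swap) simp
    also have "\<dots> \<le> (\<Sum>x\<in>X. \<Sum>y\<in>X. \<bar>?E xs x y\<bar>)"
    proof (intro sum_mono)
      fix x y assume "x \<in> X" "y \<in> X"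
      then have "\<bar>s xs x\<bar> * \<bar>s xs y\<bar> \<le> 1" using s[OF xs] by (intro mult_le_one) auto
      then have "\<bar>s xs x * s xs y * ?E xs x y\<bar> \<le> \<bar>?E xs x y\<bar>"
        by (simp only: abs_mult) (rule mult_left_le_one_le, auto)
      then show "s xs x * s xs y * ?E xs x y \<le> \<bar>?E xs x y\<bar>" by linarith
    qed
    finally show ?thesis .
  qed
  have E: "(\<Sum>xs\<in>tuples X t. \<bar>?E xs x y\<bar>) \<le> (1 + p) ^ t * (4 * \<kappa> * n ^ t * m * ?c)"
    if "x \<in> X" "y \<in> X" for x y
  proof (rule V_deviation)
    show "0 < ?c" using d_pos by simp
    fix w assume "w \<in> W"
    have "\<bar>G x w\<bar> * \<bar>G y w\<bar> \<le> (1 + d) * (1 + d)"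
      using G_bound(2)[OF _ \<open>w \<in> W\<close>] that d_pos by (intro mult_mono) auto
    then show "\<bar>G x w * G y w\<bar> \<le> ?c" by (simp add: abs_mult power2_eq_square)
  qed
  have "(\<Sum>xs\<in>tuples X t. \<Sum>w\<in>W. V xs w * (?A xs w)\<^sup>2)
      = (\<Sum>xs\<in>tuples X t. p ^ t * (\<Sum>w\<in>W. (?A xs w)\<^sup>2))
        + (\<Sum>xs\<in>tuples X t. \<Sum>w\<in>W. (V xs w - p ^ t) * (?A xs w)\<^sup>2)"
    unfolding sum.distrib[symmetric] sum_distrib_left
    by (intro sum.cong refl) (simp add: algebra_simps)
  also have "\<dots> \<le> (\<Sum>xs\<in>tuples X t. p ^ t * (?K * (n\<^sup>2 * m)))
        + (\<Sum>xs\<in>tuples X t. \<Sum>x\<in>X. \<Sum>y\<in>X. \<bar>?E xs x y\<bar>)"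
    using s p_pos by (intro add_mono sum_mono dev mult_left_mono sum_signed_degree_sq) auto
  also have "(\<Sum>xs\<in>tuples X t. \<Sum>x\<in>X. \<Sum>y\<in>X. \<bar>?E xs x y\<bar>)
      = (\<Sum>x\<in>X. \<Sum>y\<in>X. \<Sum>xs\<in>tuples X t. \<bar>?E xs x y\<bar>)"
    by (subst sum.swap, intro sum.cong refl, subst sum.swap) simp
  also have "\<dots> \<le> (\<Sum>x\<in>X. \<Sum>y\<in>X. (1 + p) ^ t * (4 * \<kappa> * n ^ t * m * ?c))"
    by (intro sum_mono E)
  finally show ?thesis
    using fin by (simp add: card_tuples algebra_simps power2_eq_square)
qed

text \<open>Replacing one factor \<open>g\<close> by \<open>d * \<nu>\<close>: a Cauchy--Schwarz argument over pairs
  \<open>(xs, w)\<close> weighted by \<open>V\<close>, with \<open>\<theta>\<close> the parameter of AM-GM.\<close>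

lemma sum_G_U:
  assumes "\<theta> > 0"
  shows "(\<Sum>xs\<in>tuples X t. \<Sum>x\<in>X. \<bar>\<Sum>w\<in>W. G x w * U xs w\<bar>)
           \<le> \<theta> / 2 * ((p ^ t + (1 + p) ^ t * (4 * \<kappa>)) * (n ^ t * m))
             + 1 / (2 * \<theta>) * ((p ^ t * (4 * (1 + d) * \<delta> * p\<^sup>2 + 4 * (1 + d)\<^sup>2 * \<kappa>)
               + (1 + p) ^ t * (4 * \<kappa> * (1 + d)\<^sup>2)) * (n ^ t * n\<^sup>2 * m))"
proof -
  \<comment> \<open>These signs turn the absolute values into a linear expression, so that the sum
    over \<open>x\<close> can be moved inside, next to \<open>U\<close>.\<close>
  define s where "s = (\<lambda>xs x. sgn (\<Sum>w\<in>W. G x w * U xs w))"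
  let ?A = "\<lambda>xs w. \<Sum>x\<in>X. s xs x * G x w"
  have "(\<Sum>x\<in>X. \<bar>\<Sum>w\<in>W. G x w * U xs w\<bar>)
      \<le> \<theta> / 2 * (\<Sum>w\<in>W. V xs w) + 1 / (2 * \<theta>) * (\<Sum>w\<in>W. V xs w * (?A xs w)\<^sup>2)"
    if xs: "xs \<in> tuples X t" for xs
  proof -
    have "(\<Sum>x\<in>X. \<bar>\<Sum>w\<in>W. G x w * U xs w\<bar>) = (\<Sum>x\<in>X. s xs x * (\<Sum>w\<in>W. G x w * U xs w))"
      by (intro sum.cong refl) (simp add: s_def abs_sgn mult.commute)
    also have "\<dots> = (\<Sum>w\<in>W. U xs w * ?A xs w)"
      unfolding sum_distrib_left by (subst sum.swap) (simp add: mult_ac)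
    also have "\<dots> \<le> (\<Sum>w\<in>W. \<theta> / 2 * V xs w + 1 / (2 * \<theta>) * (V xs w * (?A xs w)\<^sup>2))"
    proof (rule sum_mono)
      fix w assume "w \<in> W"
      let ?a = "?A xs w"
      have UV: "0 \<le> U xs w" "U xs w \<le> V xs w"
        using U_V_bounds[of xs w] xs \<open>w \<in> W\<close> by (auto simp: tuples_def)
      \<comment> \<open>AM-GM comes before \<open>U\<close> is replaced by \<open>V\<close>:
        \<open>?a\<close> has no fixed sign, but the bound obtained for it is nonnegative and
        therefore monotone in the weight.\<close>
      have "0 \<le> (\<theta> - ?a)\<^sup>2" by simp
      then have a: "?a \<le> \<theta> / 2 + 1 / (2 * \<theta>) * ?a\<^sup>2"
        using \<open>\<theta> > 0\<close> by (simp add: field_simps power2_eq_square)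
      have "U xs w * ?a \<le> U xs w * (\<theta> / 2 + 1 / (2 * \<theta>) * ?a\<^sup>2)"
        using a UV(1) by (rule mult_left_mono)
      also have "\<dots> \<le> V xs w * (\<theta> / 2 + 1 / (2 * \<theta>) * ?a\<^sup>2)"
        using UV(2) \<open>\<theta> > 0\<close> by (intro mult_right_mono) auto
      finally show "U xs w * ?a \<le> \<theta> / 2 * V xs w + 1 / (2 * \<theta>) * (V xs w * ?a\<^sup>2)"
        by (simp add: algebra_simps)
    qed
    finally show ?thesis by (simp only: sum.distrib sum_distrib_left)
  qed
  then have "(\<Sum>xs\<in>tuples X t. \<Sum>x\<in>X. \<bar>\<Sum>w\<in>W. G x w * U xs w\<bar>)
      \<le> (\<Sum>xs\<in>tuples X t. \<theta> / 2 * (\<Sum>w\<in>W. V xs w)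
           + 1 / (2 * \<theta>) * (\<Sum>w\<in>W. V xs w * (?A xs w)\<^sup>2))"
    by (rule sum_mono)
  also have "\<dots> = \<theta> / 2 * (\<Sum>xs\<in>tuples X t. \<Sum>w\<in>W. V xs w)
           + 1 / (2 * \<theta>) * (\<Sum>xs\<in>tuples X t. \<Sum>w\<in>W. V xs w * (?A xs w)\<^sup>2)"
    by (simp only: sum.distrib sum_distrib_left)
  also have "\<dots> \<le> \<theta> / 2 * ((p ^ t + (1 + p) ^ t * (4 * \<kappa>)) * (n ^ t * m))
             + 1 / (2 * \<theta>) * ((p ^ t * (4 * (1 + d) * \<delta> * p\<^sup>2 + 4 * (1 + d)\<^sup>2 * \<kappa>)
               + (1 + p) ^ t * (4 * \<kappa> * (1 + d)\<^sup>2)) * (n ^ t * n\<^sup>2 * m))"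
    using \<open>\<theta> > 0\<close>
    by (intro add_mono mult_left_mono sum_V_le sum_V_signed_degree_sq)
       (auto simp: s_def abs_sgn_eq)
  finally show ?thesis .
qed

text \<open>The choice \<open>\<theta> = \<eta> * p * n\<close> matches the root mean square of the
  signed degrees, so both AM-GM terms have the order of the main term: they contribute
  \<open>\<eta>\<close> and \<open>\<eta> / 2\<close>. The condition on \<open>\<delta>\<close> is
  free of \<open>p\<close>; only those on \<open>\<kappa>\<close> involve \<open>p\<close> and
  \<open>t\<close>.\<close>

lemma sum_G_U_small:
  assumes "\<eta> > 0" and \<delta>: "8 * (1 + d) * \<delta> \<le> \<eta>\<^sup>2"
    and \<kappa>1: "(1 + p) ^ t * (4 * \<kappa>) \<le> p ^ t"
    and \<kappa>2: "(p ^ t + (1 + p) ^ t) * (8 * (1 + d)\<^sup>2 * \<kappa>) \<le> \<eta>\<^sup>2 * p ^ (t + 2)"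
  shows "(\<Sum>xs\<in>tuples X t. \<Sum>x\<in>X. \<bar>\<Sum>w\<in>W. G x w * U xs w\<bar>)
           \<le> 2 * \<eta> * (p ^ Suc t * n ^ Suc t * m)"
proof -
  let ?\<theta> = "\<eta> * p * n"
  have pos: "?\<theta> > 0" using assms(1) p_pos n_pos by simp
  have "a * (4 * c * \<delta> * q + 4 * e * \<kappa>) + b * (4 * \<kappa> * e)
      = a * q * (8 * c * \<delta>) / 2 + (a + b) * (8 * e * \<kappa>) / 2" for a b c e q :: real
    by (simp add: algebra_simps)
  then have "p ^ t * (4 * (1 + d) * \<delta> * p\<^sup>2 + 4 * (1 + d)\<^sup>2 * \<kappa>) + (1 + p) ^ t * (4 * \<kappa> * (1 + d)\<^sup>2)
      = p ^ t * p\<^sup>2 * (8 * (1 + d) * \<delta>) / 2 + (p ^ t + (1 + p) ^ t) * (8 * (1 + d)\<^sup>2 * \<kappa>) / 2" .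
  also have "\<dots> \<le> p ^ t * p\<^sup>2 * \<eta>\<^sup>2 / 2 + \<eta>\<^sup>2 * p ^ (t + 2) / 2"
    using p_pos \<delta> \<kappa>2 by (intro add_mono mult_left_mono divide_right_mono) auto
  also have "\<dots> = \<eta>\<^sup>2 * p ^ (t + 2)"
    by (simp only: power_add mult.commute field_sum_of_halves)
  finally have K: "p ^ t * (4 * (1 + d) * \<delta> * p\<^sup>2 + 4 * (1 + d)\<^sup>2 * \<kappa>)
      + (1 + p) ^ t * (4 * \<kappa> * (1 + d)\<^sup>2) \<le> \<eta>\<^sup>2 * p ^ (t + 2)" .
  have "(\<Sum>xs\<in>tuples X t. \<Sum>x\<in>X. \<bar>\<Sum>w\<in>W. G x w * U xs w\<bar>)
      \<le> ?\<theta> / 2 * ((2 * p ^ t) * (n ^ t * m))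
        + 1 / (2 * ?\<theta>) * ((\<eta>\<^sup>2 * p ^ (t + 2)) * (n ^ t * n\<^sup>2 * m))"
  proof (rule order.trans[OF sum_G_U[OF pos] add_mono])
    show "?\<theta> / 2 * ((p ^ t + (1 + p) ^ t * (4 * \<kappa>)) * (n ^ t * m)) \<le> ?\<theta> / 2 * ((2 * p ^ t) * (n ^ t * m))"
      using pos \<kappa>1 by (intro mult_left_mono mult_right_mono) (linarith | simp)+
    show "1 / (2 * ?\<theta>) * ((p ^ t * (4 * (1 + d) * \<delta> * p\<^sup>2 + 4 * (1 + d)\<^sup>2 * \<kappa>)
      + (1 + p) ^ t * (4 * \<kappa> * (1 + d)\<^sup>2)) * (n ^ t * n\<^sup>2 * m))
      \<le> 1 / (2 * ?\<theta>) * ((\<eta>\<^sup>2 * p ^ (t + 2)) * (n ^ t * n\<^sup>2 * m))"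
      using pos by (intro mult_left_mono[OF mult_right_mono[OF K]]) simp_all
  qed
  also have "\<dots> = (3 / 2) * \<eta> * (p ^ Suc t * n ^ Suc t * m)"
  proof -
    have "\<eta> * p * n / 2 * ((2 * a) * (b * m)) + 1 / (2 * (\<eta> * p * n)) * ((\<eta>\<^sup>2 * (a * p\<^sup>2)) * (b * n\<^sup>2 * m))
        = (3 / 2) * \<eta> * (p * a * (n * b) * m)" for a b
      using assms(1) p_pos n_pos by (simp add: field_simps power2_eq_square)
    then show ?thesis by (simp only: power_add power_Suc)
  qed
  also have "\<dots> \<le> 2 * \<eta> * (p ^ Suc t * n ^ Suc t * m)"
    using assms(1) p_pos by (intro mult_right_mono) auto
  finally show ?thesis .
qed

text \<open>Write \<open>g x = G x + d * (\<nu> x - p) + d * p\<close>. In the middle term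
  \<open>U\<close> is merely bounded by 1, which \<open>\<kappa>\<close> can afford; the first term
  is kept for \<open>sum_G_U_small\<close>.\<close>

lemma U_deviation_Suc:
  "(\<Sum>xs\<in>tuples X (Suc t). \<bar>(\<Sum>w\<in>W. U xs w) - (d * p) ^ Suc t * m\<bar>)
     \<le> (\<Sum>xs\<in>tuples X t. \<Sum>x\<in>X. \<bar>\<Sum>w\<in>W. G x w * U xs w\<bar>)
       + d * (4 * \<kappa> * n * m) * n ^ t
       + d * p * n * (\<Sum>xs\<in>tuples X t. \<bar>(\<Sum>w\<in>W. U xs w) - (d * p) ^ t * m\<bar>)"
proof -
  let ?D = "\<lambda>xs. \<bar>(\<Sum>w\<in>W. U xs w) - (d * p) ^ t * m\<bar>"
  have step: "(\<Sum>x\<in>X. \<bar>(\<Sum>w\<in>W. U (x # xs) w) - (d * p) ^ Suc t * m\<bar>)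
      \<le> (\<Sum>x\<in>X. \<bar>\<Sum>w\<in>W. G x w * U xs w\<bar>) + d * (4 * \<kappa> * n * m) + d * p * n * ?D xs"
    if xs: "xs \<in> tuples X t" for xs
  proof -
    have "\<bar>(\<Sum>w\<in>W. U (x # xs) w) - (d * p) ^ Suc t * m\<bar>
        \<le> \<bar>\<Sum>w\<in>W. G x w * U xs w\<bar> + d * \<bar>\<Sum>w\<in>W. (\<nu> x w - p) * U xs w\<bar> + d * p * ?D xs" for x
    proof -
      let ?a = "\<Sum>w\<in>W. G x w * U xs w" and ?b = "\<Sum>w\<in>W. (\<nu> x w - p) * U xs w"
      let ?c = "(\<Sum>w\<in>W. U xs w) - (d * p) ^ t * m"
      have "(\<Sum>w\<in>W. U (x # xs) w)
          = (\<Sum>w\<in>W. G x w * U xs w + d * ((\<nu> x w - p) * U xs w) + d * p * U xs w)"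
        by (intro sum.cong refl) (simp add: algebra_simps)
      also have "\<dots> = ?a + d * ?b + d * p * (\<Sum>w\<in>W. U xs w)"
        by (simp only: sum.distrib sum_distrib_left)
      finally have "(\<Sum>w\<in>W. U (x # xs) w) - (d * p) ^ Suc t * m = ?a + d * ?b + d * p * ?c"
        by (simp add: algebra_simps)
      then have "\<bar>(\<Sum>w\<in>W. U (x # xs) w) - (d * p) ^ Suc t * m\<bar>
          \<le> \<bar>?a\<bar> + \<bar>d * ?b\<bar> + \<bar>d * p * ?c\<bar>" by linarith
      then show ?thesis using d_pos p_pos by (simp add: abs_mult)
    qed
    then have "(\<Sum>x\<in>X. \<bar>(\<Sum>w\<in>W. U (x # xs) w) - (d * p) ^ Suc t * m\<bar>)
        \<le> (\<Sum>x\<in>X. \<bar>\<Sum>w\<in>W. G x w * U xs w\<bar> + d * \<bar>\<Sum>w\<in>W. (\<nu> x w - p) * U xs w\<bar> + d * p * ?D xs)"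
      by (rule sum_mono)
    also have "\<dots> = (\<Sum>x\<in>X. \<bar>\<Sum>w\<in>W. G x w * U xs w\<bar>)
        + d * (\<Sum>x\<in>X. \<bar>\<Sum>w\<in>W. (\<nu> x w - p) * U xs w\<bar>) + d * p * n * ?D xs"
      by (simp add: sum.distrib sum_distrib_left)
    also have "(\<Sum>x\<in>X. \<bar>\<Sum>w\<in>W. (\<nu> x w - p) * U xs w\<bar>) \<le> 4 * (\<kappa> * n * m) * 1"
    proof (rule cut_bounded_weight[OF cut_\<nu> fin])
      fix w assume "w \<in> W"
      then show "\<bar>U xs w\<bar> \<le> 1"
        using U_V_bounds[of xs w] xs by (auto simp: tuples_def)
    qed simp
    finally show ?thesis using d_pos by simp
  qed
  have "(\<Sum>xs\<in>tuples X (Suc t). \<bar>(\<Sum>w\<in>W. U xs w) - (d * p) ^ Suc t * m\<bar>)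
      \<le> (\<Sum>xs\<in>tuples X t. (\<Sum>x\<in>X. \<bar>\<Sum>w\<in>W. G x w * U xs w\<bar>)
            + d * (4 * \<kappa> * n * m) + d * p * n * ?D xs)"
    unfolding sum_tuples_Suc by (rule sum_mono[OF step])
  also have "\<dots> = (\<Sum>xs\<in>tuples X t. \<Sum>x\<in>X. \<bar>\<Sum>w\<in>W. G x w * U xs w\<bar>)
       + d * (4 * \<kappa> * n * m) * n ^ t + d * p * n * (\<Sum>xs\<in>tuples X t. ?D xs)"
    using fin by (simp add: sum.distrib sum_distrib_left card_tuples)
  finally show ?thesis .
qed

end

section \<open>The relative counting statement and its constants\<close>

text \<open>Allows the constants from the induction hypothesis to be merged with the new ones by
  taking minima.\<close>

lemma relative_bigraph_mono:
  assumes "relative_bigraph X W \<nu> g p d \<kappa> \<delta>" "\<kappa> \<le> \<kappa>'" "\<delta> \<le> \<delta>'"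
  shows "relative_bigraph X W \<nu> g p d \<kappa>' \<delta>'"
proof -
  interpret relative_bigraph X W \<nu> g p d \<kappa> \<delta> by fact
  show ?thesis
  proof
    show "cut_bounded X W (\<lambda>x w. \<nu> x w - p) (\<kappa>' * n * m)"
      using assms(2) by (intro cut_bounded_mono[OF cut_\<nu>] mult_right_mono) auto
    show "cut_bounded X W (\<lambda>x w. G x w) (\<delta>' * p * n * m)"
      using assms(3) p_pos by (intro cut_bounded_mono[OF cut_g] mult_right_mono) auto
  qed (use fin X_nonempty p_pos d_pos g_bounds \<nu>_le_1 in auto)
qed

text \<open>The order \<open>\<delta>\<close>, \<open>p\<close>, \<open>\<kappa>\<close> mirrors
  \<open>\<delta>3\<close>, \<open>d2\<close>, \<open>\<delta>2\<close> in the theorem. The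
  induction keeps \<open>\<epsilon>\<close> arbitrary because each step asks for a smaller error on
  shorter tuples.\<close>

lemma relative_counting:
  assumes "\<epsilon> > 0" "d > 0"
  shows "\<exists>\<delta>>0. \<forall>p>0. \<exists>\<kappa>>0. \<forall>(X :: 'a set) (W :: 'b set) \<nu> g.
    relative_bigraph X W \<nu> g p d \<kappa> \<delta> \<longrightarrow>
      (\<Sum>xs\<in>tuples X t. \<bar>(\<Sum>w\<in>W. \<Prod>x\<leftarrow>xs. g x w) - (d * p) ^ t * card W\<bar>)
        \<le> \<epsilon> * (p ^ t * real (card X) ^ t * card W)"
  using assms(1)
proof (induction t arbitrary: \<epsilon>)
  case 0
  \<comment> \<open>The empty product counts \<open>W\<close> exactly, so any positive constants
    serve.\<close>
  then have "\<epsilon> * m \<ge> 0" if "m \<ge> 0" for m :: real using that by simp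
  then show ?case by (intro exI[of _ "1::real"] conjI allI impI) simp_all
next
  case (Suc t)
  \<comment> \<open>The budget is \<open>2 * \<eta> = \<epsilon> / 4\<close> for the factor
    \<open>G\<close>, \<open>\<epsilon> / 4\<close> for \<open>\<nu> - p\<close>, and
    \<open>\<epsilon> / 2\<close> for the shorter tuples; the last is multiplied by \<open>d\<close>
    on the way, whence \<open>\<epsilon> / (2 * d)\<close>.\<close>
  define \<eta> where "\<eta> = \<epsilon> / 8"
  have "\<eta> > 0" "\<epsilon> / (2 * d) > 0" using Suc.prems \<open>d > 0\<close> by (simp_all add: \<eta>_def)
  obtain \<delta>0 where "\<delta>0 > 0" and IH: "\<forall>p>0. \<exists>\<kappa>>0. \<forall>(X :: 'a set) (W :: 'b set) \<nu> g.
    relative_bigraph X W \<nu> g p d \<kappa> \<delta>0 \<longrightarrow>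
      (\<Sum>xs\<in>tuples X t. \<bar>(\<Sum>w\<in>W. \<Prod>x\<leftarrow>xs. g x w) - (d * p) ^ t * card W\<bar>)
        \<le> \<epsilon> / (2 * d) * (p ^ t * real (card X) ^ t * card W)"
    using Suc.IH[OF \<open>\<epsilon> / (2 * d) > 0\<close>] by (elim exE conjE)
  define \<delta> where "\<delta> = min \<delta>0 (\<eta>\<^sup>2 / (8 * (1 + d)))"
  have "\<delta> > 0" using \<open>\<delta>0 > 0\<close> \<open>\<eta> > 0\<close> \<open>d > 0\<close> by (simp add: \<delta>_def)
  have \<delta>: "8 * (1 + d) * \<delta> \<le> \<eta>\<^sup>2"
  proof -
    have "\<delta> \<le> \<eta>\<^sup>2 / (8 * (1 + d))" by (simp add: \<delta>_def)
    then show ?thesis using \<open>d > 0\<close> by (simp add: pos_le_divide_eq mult.commute)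
  qed
  show ?case
  proof (rule exI[of _ \<delta>], intro conjI \<open>\<delta> > 0\<close> allI impI)
    fix p :: real assume "p > 0"
    obtain \<kappa>0 where "\<kappa>0 > 0" and IH': "\<And>(X :: 'a set) (W :: 'b set) \<nu> g.
      relative_bigraph X W \<nu> g p d \<kappa>0 \<delta>0 \<Longrightarrow>
      (\<Sum>xs\<in>tuples X t. \<bar>(\<Sum>w\<in>W. \<Prod>x\<leftarrow>xs. g x w) - (d * p) ^ t * card W\<bar>)
        \<le> \<epsilon> / (2 * d) * (p ^ t * real (card X) ^ t * card W)"
      using IH[rule_format, OF \<open>p > 0\<close>] by (elim exE conjE) (rule that, auto)
    \<comment> \<open>\<open>\<kappa>1\<close> and \<open>\<kappa>2\<close> are the thresholds of
      \<open>sum_G_U_small\<close>; \<open>\<kappa>3\<close> brings the error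
      \<open>4 * d * \<kappa>\<close> of the middle term below \<open>\<epsilon> / 4\<close> times
      \<open>p ^ Suc t\<close>.\<close>
    define \<kappa>1 where "\<kappa>1 = p ^ t / ((1 + p) ^ t * 4)"
    define \<kappa>2 where "\<kappa>2 = \<eta>\<^sup>2 * p ^ (t + 2) / ((p ^ t + (1 + p) ^ t) * (8 * (1 + d)\<^sup>2))"
    define \<kappa>3 where "\<kappa>3 = \<epsilon> * p ^ Suc t / (4 * (4 * d))"
    define \<kappa> where "\<kappa> = min \<kappa>0 (min \<kappa>1 (min \<kappa>2 \<kappa>3))"
    have sumpos: "p ^ t + (1 + p) ^ t > 0" using \<open>p > 0\<close> by (simp add: add_pos_pos)
    have "\<kappa>1 > 0" "\<kappa>2 > 0" "\<kappa>3 > 0"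
      using \<open>p > 0\<close> \<open>\<eta> > 0\<close> \<open>d > 0\<close> Suc.prems sumpos
      by (auto simp: \<kappa>1_def \<kappa>2_def \<kappa>3_def)
    then have "\<kappa> > 0" using \<open>\<kappa>0 > 0\<close> by (simp add: \<kappa>_def)
    have "\<kappa> \<le> \<kappa>0" "\<kappa> \<le> \<kappa>1" "\<kappa> \<le> \<kappa>2" "\<kappa> \<le> \<kappa>3" by (auto simp: \<kappa>_def)
    have k1: "(1 + p) ^ t * (4 * \<kappa>) \<le> p ^ t"
      using \<open>\<kappa> \<le> \<kappa>1\<close> \<open>p > 0\<close> by (simp add: \<kappa>1_def pos_le_divide_eq mult_ac)
    have k2: "(p ^ t + (1 + p) ^ t) * (8 * (1 + d)\<^sup>2 * \<kappa>) \<le> \<eta>\<^sup>2 * p ^ (t + 2)"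
    proof -
      have "(p ^ t + (1 + p) ^ t) * (8 * (1 + d)\<^sup>2) > 0" using sumpos \<open>d > 0\<close> by simp
      then show ?thesis using \<open>\<kappa> \<le> \<kappa>2\<close>
        by (simp add: \<kappa>2_def pos_le_divide_eq mult.commute mult.left_commute)
    qed
    have k3: "4 * (4 * d * \<kappa>) \<le> \<epsilon> * p ^ Suc t"
      using \<open>\<kappa> \<le> \<kappa>3\<close> \<open>d > 0\<close> by (simp add: \<kappa>3_def pos_le_divide_eq mult_ac)
    show "\<exists>\<kappa>>0. \<forall>(X :: 'a set) (W :: 'b set) \<nu> g.
      relative_bigraph X W \<nu> g p d \<kappa> \<delta> \<longrightarrow>
        (\<Sum>xs\<in>tuples X (Suc t). \<bar>(\<Sum>w\<in>W. \<Prod>x\<leftarrow>xs. g x w) - (d * p) ^ Suc t * card W\<bar>)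
          \<le> \<epsilon> * (p ^ Suc t * real (card X) ^ Suc t * card W)"
    proof (intro exI[of _ \<kappa>] conjI \<open>\<kappa> > 0\<close> allI impI)
      fix X :: "'a set" and W :: "'b set" and \<nu> g
      assume rb: "relative_bigraph X W \<nu> g p d \<kappa> \<delta>"
      interpret relative_bigraph X W \<nu> g p d \<kappa> \<delta> by fact
      let ?N = "p ^ Suc t * n ^ Suc t * m"
      have "(\<Sum>xs\<in>tuples X (Suc t). \<bar>(\<Sum>w\<in>W. U xs w) - (d * p) ^ Suc t * m\<bar>)
         \<le> (\<Sum>xs\<in>tuples X t. \<Sum>x\<in>X. \<bar>\<Sum>w\<in>W. G x w * U xs w\<bar>)
           + d * (4 * \<kappa> * n * m) * n ^ t
           + d * p * n * (\<Sum>xs\<in>tuples X t. \<bar>(\<Sum>w\<in>W. U xs w) - (d * p) ^ t * m\<bar>)"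
        by (rule U_deviation_Suc)
      also have "\<dots> \<le> 2 * \<eta> * ?N + (\<epsilon> / 4) * ?N
          + d * p * n * (\<epsilon> / (2 * d) * (p ^ t * n ^ t * m))"
      proof (intro add_mono mult_left_mono)
        show "(\<Sum>xs\<in>tuples X t. \<Sum>x\<in>X. \<bar>\<Sum>w\<in>W. G x w * U xs w\<bar>) \<le> 2 * \<eta> * ?N"
          by (rule sum_G_U_small[OF \<open>\<eta> > 0\<close> \<delta> k1 k2])
        have "d * (4 * \<kappa> * n * m) * n ^ t = (4 * (4 * d * \<kappa>)) * (n ^ Suc t * m / 4)"
          by simp
        also have "\<dots> \<le> (\<epsilon> * p ^ Suc t) * (n ^ Suc t * m / 4)"
          by (rule mult_right_mono[OF k3]) simp
        finally show "d * (4 * \<kappa> * n * m) * n ^ t \<le> (\<epsilon> / 4) * ?N" by (simp add: mult_ac)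
        show "(\<Sum>xs\<in>tuples X t. \<bar>(\<Sum>w\<in>W. U xs w) - (d * p) ^ t * m\<bar>)
            \<le> \<epsilon> / (2 * d) * (p ^ t * n ^ t * m)"
          by (rule IH'[OF relative_bigraph_mono[OF rb]]) (use \<open>\<kappa> \<le> \<kappa>0\<close> in \<open>auto simp: \<delta>_def\<close>)
      qed (use d_pos p_pos in auto)
      also have "\<dots> = \<epsilon> * ?N" using \<open>d > 0\<close> by (simp add: \<eta>_def field_simps)
      finally show "(\<Sum>xs\<in>tuples X (Suc t). \<bar>(\<Sum>w\<in>W. U xs w) - (d * p) ^ Suc t * m\<bar>) \<le> \<epsilon> * ?N" .
    qed
  qed
qed

section \<open>Edge and triangle counts as sums of indicators\<close>

lemma card_filter_eq_sum_of_bool: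
  "finite A \<Longrightarrow> real (card {x \<in> A. Q x}) = (\<Sum>x\<in>A. of_bool (Q x))"
  by (simp add: of_bool_def sum.If_cases Int_def)

lemma card_edges_between:
  assumes "finite A" "finite B" "A \<inter> B = {}"
  shows "real (card (edges_between G A B)) = (\<Sum>a\<in>A. \<Sum>b\<in>B. of_bool ({a, b} \<in> G))"
proof -
  let ?S = "{w \<in> A \<times> B. {fst w, snd w} \<in> G}"
  have "edges_between G A B = (\<lambda>(a, b). {a, b}) ` ?S"
    by (force simp: edges_between_def cross_pairs_def)
  moreover have "inj_on (\<lambda>(a, b). {a, b}) ?S"
    using assms(3) by (auto simp: inj_on_def doubleton_eq_iff)
  ultimately have "card (edges_between G A B) = card ?S"
    by (simp add: card_image)
  then show ?thesis
    using assms(1,2) by (simp only: card_filter_eq_sum_of_bool finite_cartesian_product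
      sum.cartesian_product case_prod_unfold)
qed

lemma triple_eq_disjoint:
  assumes "X \<inter> Y = {}" "Y \<inter> Z = {}" "X \<inter> Z = {}"
    and "x \<in> X" "y \<in> Y" "z \<in> Z" "x' \<in> X" "y' \<in> Y" "z' \<in> Z"
    and eq: "{x, y, z} = {x', y', z'}"
  shows "x = x' \<and> y = y' \<and> z = z'"
proof -
  have "{x, y, z} \<inter> X = {x}" "{x', y', z'} \<inter> X = {x'}"
    "{x, y, z} \<inter> Y = {y}" "{x', y', z'} \<inter> Y = {y'}"
    "{x, y, z} \<inter> Z = {z}" "{x', y', z'} \<inter> Z = {z'}"
    using assms(1-9) by auto
  then have "{x} = {x'}" "{y} = {y'}" "{z} = {z'}" unfolding eq by simp_all
  then show ?thesis by simp
qed

lemma finite_cross_triples: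
  assumes "finite X" "finite Y" "finite Z"
  shows "finite (cross_triples X Y Z)"
proof -
  have "cross_triples X Y Z = (\<lambda>(x, y, z). {x, y, z}) ` (X \<times> Y \<times> Z)"
    by (force simp: cross_triples_def)
  then show ?thesis using assms by simp
qed

text \<open>Disjointness of the classes makes a triple determine its ordered form. Splitting off
  \<open>x\<close> from the pair \<open>(y, z)\<close> gives the matrix sums used by
  \<open>cut_bounded\<close>.\<close>

lemma card_cross_triples_subset:
  assumes fin: "finite X" "finite Y" "finite Z"
    and disj: "X \<inter> Y = {}" "Y \<inter> Z = {}" "X \<inter> Z = {}"
    and S: "S \<subseteq> cross_triples X Y Z"
  shows "real (card S) = (\<Sum>x\<in>X. \<Sum>(y, z)\<in>Y \<times> Z. of_bool ({x, y, z} \<in> S))"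
proof -
  let ?S = "{w \<in> X \<times> Y \<times> Z. {fst w, fst (snd w), snd (snd w)} \<in> S}"
  let ?F = "\<lambda>(x, y, z). {x, y, z}"
  have eq: "S = ?F ` ?S"
  proof (intro equalityI subsetI)
    fix T assume "T \<in> S"
    with S obtain x y z where "x \<in> X" "y \<in> Y" "z \<in> Z" "T = {x, y, z}"
      by (auto simp: cross_triples_def)
    with \<open>T \<in> S\<close> have "(x, y, z) \<in> ?S" "T = ?F (x, y, z)" by auto
    then show "T \<in> ?F ` ?S" by (rule rev_image_eqI)
  qed auto
  have "inj_on ?F ?S"
  proof (rule inj_onI)
    fix v w assume "v \<in> ?S" "w \<in> ?S" "?F v = ?F w"
    then show "v = w"
      using triple_eq_disjoint[OF disj, of "fst v" "fst (snd v)" "snd (snd v)" "fst w" "fst (snd w)" "snd (snd w)"]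
      by (simp add: case_prod_unfold mem_Times_iff prod_eq_iff)
  qed
  then have "card S = card ?S"
    by (rule trans[OF arg_cong[OF eq, of card] card_image])
  then show ?thesis
    using fin by (simp only: card_filter_eq_sum_of_bool finite_cartesian_product
      sum.cartesian_product case_prod_unfold)
qed

lemma pair_in_cross_pairs:
  "{a, b} \<in> cross_pairs A B \<longleftrightarrow> a \<in> A \<and> b \<in> B \<or> b \<in> A \<and> a \<in> B"
  by (auto simp: cross_pairs_def doubleton_eq_iff)

text \<open>No edge lies inside a class, so the three vertices of a triangle occupy different
  classes; the final call runs through the possible assignments.\<close>

lemma triangles_cross_triples:
  assumes disj: "X \<inter> Y = {}" "Y \<inter> Z = {}" "X \<inter> Z = {}"
    and Q: "tripartite_graph X Y Z Q"
  shows "triangles Q \<subseteq> cross_triples X Y Z"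
proof
  fix T assume T: "T \<in> triangles Q"
  then obtain a b c where abc: "T = {a, b, c}" "a \<noteq> b" "b \<noteq> c" "a \<noteq> c"
    by (auto simp: triangles_def card_3_iff)
  have "{a, b} \<in> Q" "{b, c} \<in> Q" "{a, c} \<in> Q"
    using T abc by (auto simp: triangles_def)
  then have *: "{a, b} \<in> cross_pairs X Y \<union> cross_pairs Y Z \<union> cross_pairs X Z"
    "{b, c} \<in> cross_pairs X Y \<union> cross_pairs Y Z \<union> cross_pairs X Z"
    "{a, c} \<in> cross_pairs X Y \<union> cross_pairs Y Z \<union> cross_pairs X Z"
    using Q by (auto simp: tripartite_graph_def)
  have intro: "{x, y, z} \<in> cross_triples X Y Z" if "x \<in> X" "y \<in> Y" "z \<in> Z" for x y z
    using that by (auto simp: cross_triples_def)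
  have perm: "{a, b, c} = {a, c, b}" "{a, b, c} = {b, a, c}" "{a, b, c} = {b, c, a}"
    "{a, b, c} = {c, a, b}" "{a, b, c} = {c, b, a}" by auto
  have nd: "\<not> (v \<in> X \<and> v \<in> Y)" "\<not> (v \<in> Y \<and> v \<in> Z)" "\<not> (v \<in> X \<and> v \<in> Z)" for v
    using disj by auto
  show "T \<in> cross_triples X Y Z"
    using * nd[of a] nd[of b] nd[of c] intro perm unfolding abc(1) Un_iff pair_in_cross_pairs
    by metis
qed

lemma triple_in_triangles:
  assumes "x \<noteq> y" "y \<noteq> z" "x \<noteq> z"
  shows "{x, y, z} \<in> triangles Q \<longleftrightarrow> {x, y} \<in> Q \<and> {x, z} \<in> Q \<and> {y, z} \<in> Q"
  using assms by (auto simp: triangles_def insert_commute)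

section \<open>The bipartite weights attached to a triad and a hypergraph\<close>

text \<open>The instance of \<open>W\<close>. Edges are oriented from \<open>Y\<close> to
  \<open>Z\<close> so that each endpoint can be addressed on its own.\<close>

definition edge_pairs :: "'a set set \<Rightarrow> 'a set \<Rightarrow> 'a set \<Rightarrow> ('a \<times> 'a) set" where
  "edge_pairs P Y Z = {(y, z) \<in> Y \<times> Z. {y, z} \<in> P}"

text \<open>The instance of \<open>\<nu>\<close>. On \<open>edge_pairs P Y Z\<close> the third edge
  is present already, so for \<open>x\<close> in \<open>X\<close> this is the indicator of a
  triangle of \<open>P\<close>.\<close>

definition cherry :: "'a set set \<Rightarrow> 'a \<Rightarrow> 'a \<times> 'a \<Rightarrow> real" where
  "cherry P x = (\<lambda>(y, z). of_bool ({x, y} \<in> P) * of_bool ({x, z} \<in> P))"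

definition hyperedge :: "'a set set \<Rightarrow> 'a \<Rightarrow> 'a \<times> 'a \<Rightarrow> real" where
  "hyperedge H x = (\<lambda>(y, z). of_bool ({x, y, z} \<in> H))"

lemma regular_cut_bounded:
  assumes reg: "bipartite_regular \<delta> d A B (edges_between G A B)"
    and fin: "finite A" "finite B" and disj: "A \<inter> B = {}"
  shows "cut_bounded A B (\<lambda>a b. of_bool ({a, b} \<in> G) - d) (\<delta> * card A * card B)"
  unfolding cut_bounded_def
proof (intro allI impI)
  fix A' B' assume sub: "A' \<subseteq> A" "B' \<subseteq> B"
  have fin': "finite A'" "finite B'" "A' \<inter> B' = {}"
    using sub fin disj finite_subset by blast+
  have "edges_between (edges_between G A B) A' B' = edges_between G A' B'"
    using sub by (auto simp: edges_between_def cross_pairs_def)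
  moreover have "(\<Sum>a\<in>A'. \<Sum>b\<in>B'. of_bool ({a, b} \<in> G) - d)
      = real (card (edges_between G A' B')) - d * real (card A') * real (card B')"
    unfolding card_edges_between[OF fin'] by (simp add: sum_subtractf mult_ac)
  ultimately show "\<bar>\<Sum>a\<in>A'. \<Sum>b\<in>B'. of_bool ({a, b} \<in> G) - d\<bar> \<le> \<delta> * card A * card B"
    using reg sub unfolding bipartite_regular_def by metis
qed

text \<open>By \<open>a * b - d\<^sup>2 = (a - d) * b + d * (b - d)\<close> each term involves the
  regularity of only one pair of classes. Although \<open>W'\<close> need not be a product set,
  fixing the remaining coordinate turns it into a weight on a single class.\<close>

lemma cherry_cut_bounded:
  assumes fin: "finite X" "finite Y" "finite Z"
    and disj: "X \<inter> Y = {}" "Y \<inter> Z = {}" "X \<inter> Z = {}"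
    and triad: "triad \<delta> d X Y Z P" and "d \<ge> 0"
  shows "cut_bounded X (edge_pairs P Y Z) (\<lambda>x w. cherry P x w - d\<^sup>2)
           ((1 + d) * \<delta> * card X * (real (card Y) * real (card Z)))"
  unfolding cut_bounded_def
proof (intro allI impI)
  fix X' W' assume X': "X' \<subseteq> X" and W': "W' \<subseteq> edge_pairs P Y Z"
  let ?n = "real (card X)" and ?k = "real (card Y)" and ?l = "real (card Z)"
  let ?a = "\<lambda>x y. of_bool ({x, y} \<in> P) :: real"
  let ?w = "\<lambda>y z. of_bool ((y, z) \<in> W') :: real"
  have XY: "cut_bounded X Y (\<lambda>x y. ?a x y - d) (\<delta> * ?n * ?k)"
    and XZ: "cut_bounded X Z (\<lambda>x z. ?a x z - d) (\<delta> * ?n * ?l)"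
    using triad fin disj by (auto simp: triad_def intro!: regular_cut_bounded)
  have "finite X'" using X' fin finite_subset by blast
  have W'YZ: "W' \<subseteq> Y \<times> Z" using W' by (auto simp: edge_pairs_def)
  have sumW: "(\<Sum>w\<in>W'. f w) = (\<Sum>y\<in>Y. \<Sum>z\<in>Z. f (y, z) * ?w y z)" for f :: "'a \<times> 'a \<Rightarrow> real"
  proof -
    have "(\<Sum>y\<in>Y. \<Sum>z\<in>Z. f (y, z) * ?w y z) = (\<Sum>w\<in>Y \<times> Z. if w \<in> W' then f w else 0)"
      by (simp add: sum.cartesian_product case_prod_unfold of_bool_def if_distrib cong: if_cong)
    also have "\<dots> = (\<Sum>w\<in>W'. f w)"
      using fin W'YZ by (simp add: sum.inter_restrict[symmetric] Int_absorb1)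
    finally show ?thesis by simp
  qed
  \<comment> \<open>For fixed \<open>z\<close> the factor \<open>?a x z\<close> shrinks
    \<open>X'\<close> to the neighbours of \<open>z\<close>, and \<open>W'\<close> becomes a 0/1
    weight on \<open>Y\<close>, so the cut bound between \<open>X\<close> and \<open>Y\<close>
    applies. In \<open>S2\<close> the fixed coordinate is \<open>y\<close>.\<close>
  define S1 where "S1 = (\<lambda>z. \<Sum>x\<in>{x \<in> X'. {x, z} \<in> P}. \<Sum>y\<in>Y. (?a x y - d) * ?w y z)"
  define S2 where "S2 = (\<lambda>y. \<Sum>x\<in>X'. \<Sum>z\<in>Z. (?a x z - d) * ?w y z)"
  have "(\<Sum>x\<in>X'. \<Sum>w\<in>W'. cherry P x w - d\<^sup>2)
      = (\<Sum>x\<in>X'. \<Sum>y\<in>Y. \<Sum>z\<in>Z. (?a x y * ?a x z - d\<^sup>2) * ?w y z)"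
    unfolding sumW by (simp add: cherry_def)
  also have "\<dots> = (\<Sum>x\<in>X'. \<Sum>y\<in>Y. \<Sum>z\<in>Z. ?a x z * ((?a x y - d) * ?w y z))
      + (\<Sum>x\<in>X'. \<Sum>y\<in>Y. \<Sum>z\<in>Z. d * ((?a x z - d) * ?w y z))"
  proof -
    have "(a * b - d\<^sup>2) * w = b * ((a - d) * w) + d * ((b - d) * w)" for a b w :: real
      by (simp add: algebra_simps power2_eq_square)
    then show ?thesis unfolding sum.distrib[symmetric] by (intro sum.cong refl)
  qed
  also have "(\<Sum>x\<in>X'. \<Sum>y\<in>Y. \<Sum>z\<in>Z. d * ((?a x z - d) * ?w y z)) = d * (\<Sum>y\<in>Y. S2 y)"
    unfolding S2_def sum_distrib_left by (rule sum.swap)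
  also have "(\<Sum>x\<in>X'. \<Sum>y\<in>Y. \<Sum>z\<in>Z. ?a x z * ((?a x y - d) * ?w y z)) = (\<Sum>z\<in>Z. S1 z)"
  proof -
    have "(\<Sum>x\<in>X'. \<Sum>y\<in>Y. \<Sum>z\<in>Z. ?a x z * ((?a x y - d) * ?w y z))
        = (\<Sum>x\<in>X'. \<Sum>z\<in>Z. ?a x z * (\<Sum>y\<in>Y. (?a x y - d) * ?w y z))"
      unfolding sum_distrib_left by (intro sum.cong[OF refl] sum.swap)
    also have "\<dots> = (\<Sum>z\<in>Z. \<Sum>x\<in>X'. if {x, z} \<in> P then \<Sum>y\<in>Y. (?a x y - d) * ?w y z else 0)"
      by (subst sum.swap) (intro sum.cong refl, simp)
    also have "\<dots> = (\<Sum>z\<in>Z. S1 z)"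
      unfolding S1_def using \<open>finite X'\<close> by (intro sum.cong[OF refl]) (rule sum.inter_filter[symmetric])
    finally show ?thesis .
  qed
  finally have eq: "(\<Sum>x\<in>X'. \<Sum>w\<in>W'. cherry P x w - d\<^sup>2) = (\<Sum>z\<in>Z. S1 z) + d * (\<Sum>y\<in>Y. S2 y)" .
  have "\<bar>\<Sum>z\<in>Z. S1 z\<bar> \<le> (\<Sum>z\<in>Z. \<delta> * ?n * ?k)"
    unfolding S1_def using X' fin
    by (intro order.trans[OF sum_abs] sum_mono cut_bounded_weight01[OF XY]) auto
  moreover have "\<bar>\<Sum>y\<in>Y. S2 y\<bar> \<le> (\<Sum>y\<in>Y. \<delta> * ?n * ?l)"
    unfolding S2_def using X' fin
    by (intro order.trans[OF sum_abs] sum_mono cut_bounded_weight01[OF XZ]) auto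
  ultimately have "\<bar>\<Sum>z\<in>Z. S1 z\<bar> + d * \<bar>\<Sum>y\<in>Y. S2 y\<bar>
      \<le> ?l * (\<delta> * ?n * ?k) + d * (?k * (\<delta> * ?n * ?l))"
    using \<open>d \<ge> 0\<close> by (intro add_mono mult_left_mono) auto
  moreover have "\<bar>(\<Sum>z\<in>Z. S1 z) + d * (\<Sum>y\<in>Y. S2 y)\<bar> \<le> \<bar>\<Sum>z\<in>Z. S1 z\<bar> + d * \<bar>\<Sum>y\<in>Y. S2 y\<bar>"
    using abs_triangle_ineq[of "\<Sum>z\<in>Z. S1 z" "d * (\<Sum>y\<in>Y. S2 y)"] \<open>d \<ge> 0\<close> by (simp add: abs_mult)
  ultimately show "\<bar>\<Sum>x\<in>X'. \<Sum>w\<in>W'. cherry P x w - d\<^sup>2\<bar> \<le> (1 + d) * \<delta> * ?n * (?k * ?l)"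
    unfolding eq by (simp add: algebra_simps)
qed

lemma sum_sum_restrict:
  fixes f :: "'a \<Rightarrow> 'b \<Rightarrow> real"
  assumes "finite A" "finite B" "A' \<subseteq> A" "B' \<subseteq> B"
  shows "(\<Sum>a\<in>A. \<Sum>b\<in>B. if a \<in> A' \<and> b \<in> B' then f a b else 0) = (\<Sum>a\<in>A'. \<Sum>b\<in>B'. f a b)"
proof -
  have "(\<Sum>a\<in>A. \<Sum>b\<in>B. if a \<in> A' \<and> b \<in> B' then f a b else 0)
      = (\<Sum>a\<in>A. if a \<in> A' then \<Sum>b\<in>B. if b \<in> B' then f a b else 0 else 0)"
    by (intro sum.cong refl) simp
  also have "\<dots> = (\<Sum>a\<in>A'. \<Sum>b\<in>B'. f a b)"
    using assms by (simp add: sum.inter_restrict[symmetric] Int_absorb1)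
  finally show ?thesis .
qed

text \<open>Each rectangle \<open>X'\<close> times \<open>W'\<close> consists of the triangles of a
  single subgraph \<open>Q\<close>, which is why a family of one subgraph suffices. If
  \<open>Q\<close> has too few triangles for regularity to speak, the trivial bound by
  \<open>1 + d\<close> times their number is small enough.\<close>

lemma hyperedge_cut_bounded:
  assumes fin: "finite X" "finite Y" "finite Z"
    and disj: "X \<inter> Y = {}" "Y \<inter> Z = {}" "X \<inter> Z = {}"
    and P: "tripartite_graph X Y Z P" and H: "H \<subseteq> triangles P"
    and reg: "hyper_regular \<delta> d 1 H P" and "\<delta> > 0" "d > 0"
    and K: "(\<Sum>x\<in>X. \<Sum>w\<in>edge_pairs P Y Z. cherry P x w) \<le> K"
  shows "cut_bounded X (edge_pairs P Y Z) (\<lambda>x w. hyperedge H x w - d * cherry P x w)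
           ((1 + d) * \<delta> * K)"
  unfolding cut_bounded_def
proof (intro allI impI)
  fix X' W' assume X': "X' \<subseteq> X" and W': "W' \<subseteq> edge_pairs P Y Z"
  have W'YZ: "W' \<subseteq> Y \<times> Z" and EYZ: "edge_pairs P Y Z \<subseteq> Y \<times> Z"
    using W' by (auto simp: edge_pairs_def)
  have finYZ: "finite (Y \<times> Z)" using fin by simp
  \<comment> \<open>All edges of \<open>P\<close> at \<open>X'\<close> are kept, and of the edges
    between \<open>Y\<close> and \<open>Z\<close> only those in \<open>W'\<close>; a triangle then
    survives exactly when its \<open>x\<close> and its pair lie in the rectangle.\<close>
  define Q where "Q = {e \<in> P. e \<in> cross_pairs X' Y \<union> cross_pairs X' Z} \<union> (\<lambda>(y, z). {y, z}) ` W'"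
  have "Q \<subseteq> P" using W' by (auto simp: Q_def edge_pairs_def)
  have ne: "x \<noteq> y" "x \<noteq> z" "y \<noteq> z" if "x \<in> X" "y \<in> Y" "z \<in> Z" for x y z
    using that disj by auto
  have TP: "triangles P \<subseteq> cross_triples X Y Z"
    by (rule triangles_cross_triples[OF disj P])
  have "triangles Q \<subseteq> triangles P"
    using \<open>Q \<subseteq> P\<close> by (auto simp: triangles_def)
  with TP have TQ: "triangles Q \<subseteq> cross_triples X Y Z" by blast
  have Qiff: "{x, y, z} \<in> triangles Q \<longleftrightarrow> x \<in> X' \<and> (y, z) \<in> W' \<and> {x, y} \<in> P \<and> {x, z} \<in> P"
    if "x \<in> X" "y \<in> Y" "z \<in> Z" for x y z
  proof -
    have "{x, y} \<in> Q \<longleftrightarrow> x \<in> X' \<and> {x, y} \<in> P" "{x, z} \<in> Q \<longleftrightarrow> x \<in> X' \<and> {x, z} \<in> P"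
      "{y, z} \<in> Q \<longleftrightarrow> (y, z) \<in> W'"
    proof -
      have "x \<notin> Y" "x \<notin> Z" "y \<notin> X" "y \<notin> Z" "z \<notin> X" "z \<notin> Y"
        using that disj by auto
      moreover from this have "y \<notin> X'" "z \<notin> X'" using X' by auto
      moreover have W'_iff: "{a, b} \<in> (\<lambda>(y, z). {y, z}) ` W' \<longleftrightarrow> (a, b) \<in> W' \<or> (b, a) \<in> W'" for a b
        by (force simp: image_iff doubleton_eq_iff)
      moreover have "(a, b) \<in> W' \<Longrightarrow> a \<in> Y \<and> b \<in> Z" for a b
        using W'YZ by auto
      moreover have "(y, z) \<in> W' \<Longrightarrow> {y, z} \<in> P" using W' by (auto simp: edge_pairs_def)
      ultimately show "{x, y} \<in> Q \<longleftrightarrow> x \<in> X' \<and> {x, y} \<in> P" "{x, z} \<in> Q \<longleftrightarrow> x \<in> X' \<and> {x, z} \<in> P"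
        "{y, z} \<in> Q \<longleftrightarrow> (y, z) \<in> W'"
        unfolding Q_def Un_iff mem_Collect_eq pair_in_cross_pairs W'_iff using that by blast+
    qed
    then show ?thesis using triple_in_triangles[OF ne(1)[OF that] ne(3)[OF that] ne(2)[OF that]]
      by auto
  qed
  have Piff: "{x, y, z} \<in> triangles P \<longleftrightarrow> (y, z) \<in> edge_pairs P Y Z \<and> {x, y} \<in> P \<and> {x, z} \<in> P"
    if "x \<in> X" "y \<in> Y" "z \<in> Z" for x y z
    using triple_in_triangles[OF ne(1)[OF that] ne(3)[OF that] ne(2)[OF that], of P] that
    by (auto simp: edge_pairs_def)
  let ?c = "\<Sum>x\<in>X'. \<Sum>w\<in>W'. cherry P x w" and ?h = "\<Sum>x\<in>X'. \<Sum>w\<in>W'. hyperedge H x w"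
  have cQ: "real (card (triangles Q)) = ?c"
    unfolding card_cross_triples_subset[OF fin disj TQ] sum_sum_restrict[OF fin(1) finYZ X' W'YZ, symmetric]
    by (intro sum.cong refl) (auto simp: Qiff cherry_def)
  have cH: "real (card (H \<inter> triangles Q)) = ?h"
  proof -
    have TH: "H \<inter> triangles Q \<subseteq> cross_triples X Y Z" using TQ by blast
    have "{x, y, z} \<in> H \<inter> triangles Q \<longleftrightarrow> x \<in> X' \<and> (y, z) \<in> W' \<and> {x, y, z} \<in> H"
      if "x \<in> X" "y \<in> Y" "z \<in> Z" for x y z
      using Qiff[OF that] Piff[OF that] H by auto
    then show ?thesis
      unfolding card_cross_triples_subset[OF fin disj TH]
        sum_sum_restrict[OF fin(1) finYZ X' W'YZ, symmetric]
      by (intro sum.cong refl) (auto simp: hyperedge_def)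
  qed
  have "real (card (triangles P)) = (\<Sum>x\<in>X. \<Sum>w\<in>edge_pairs P Y Z. cherry P x w)"
    unfolding card_cross_triples_subset[OF fin disj TP]
      sum_sum_restrict[OF fin(1) finYZ order_refl EYZ, symmetric]
    by (intro sum.cong refl) (auto simp: Piff cherry_def)
  with K have cP: "real (card (triangles P)) \<le> K" by simp
  have "finite (triangles Q)"
    by (rule finite_subset[OF TQ finite_cross_triples[OF fin]])
  then have "?h \<le> ?c" unfolding cH[symmetric] cQ[symmetric]
    by (simp add: card_mono)
  moreover have "0 \<le> ?h" unfolding cH[symmetric] by simp
  ultimately have triv: "\<bar>?h - d * ?c\<bar> \<le> (1 + d) * ?c"
  proof -
    assume *: "?h \<le> ?c" "0 \<le> ?h"
    then have "0 \<le> d * ?c" using \<open>d > 0\<close> by simp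
    moreover have "(1 + d) * ?c = ?c + d * ?c" by (simp add: distrib_right)
    ultimately show ?thesis using * by linarith
  qed
  have "\<bar>?h - d * ?c\<bar> \<le> (1 + d) * (\<delta> * real (card (triangles P)))"
  \<comment> \<open>Regularity says nothing if \<open>Q\<close> is below the threshold or if
    \<open>P\<close> has no triangle at all; both cases fall to the trivial bound.\<close>
  proof (cases "?c < \<delta> * real (card (triangles P)) \<or> card (triangles P) = 0")
    case True
    have "?c \<le> \<delta> * real (card (triangles P))"
    proof (cases "card (triangles P) = 0")
      case True
      have "finite (triangles P)"
    by (rule finite_subset[OF TP finite_cross_triples[OF fin]])
      with True \<open>triangles Q \<subseteq> triangles P\<close> have "triangles Q = {}" by auto
      then show ?thesis unfolding cQ[symmetric] using True by simp
    qed (use True in auto)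
    then have "(1 + d) * ?c \<le> (1 + d) * (\<delta> * real (card (triangles P)))"
      using \<open>d > 0\<close> by (intro mult_left_mono) auto
    with triv show ?thesis by linarith
  next
    case False
    then have "\<bar>?h - d * ?c\<bar> \<le> \<delta> * real (card (triangles P))"
      using reg[unfolded hyper_regular_def, rule_format, of "\<lambda>_. Q"] \<open>Q \<subseteq> P\<close> \<open>\<delta> > 0\<close>
      unfolding cH[symmetric] cQ[symmetric] by (auto simp: not_less)
    also have "\<dots> \<le> (1 + d) * (\<delta> * real (card (triangles P)))"
      using \<open>d > 0\<close> \<open>\<delta> > 0\<close> by (simp add: algebra_simps)
    finally show ?thesis .
  qed
  also have "\<dots> \<le> (1 + d) * (\<delta> * K)"
    using cP \<open>d > 0\<close> \<open>\<delta> > 0\<close> by (intro mult_left_mono) auto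
  finally show "\<bar>\<Sum>x\<in>X'. \<Sum>w\<in>W'. hyperedge H x w - d * cherry P x w\<bar> \<le> (1 + d) * \<delta> * K"
    by (simp add: sum_subtractf sum_distrib_left mult.assoc)
qed

section \<open>Joint links as common neighbourhoods\<close>

text \<open>The factors are 0 or 1, so a repeated vertex changes neither side and the formula covers
  tuples with repetitions. The list is nonempty because an intersection over no vertices would be
  the whole type.\<close>

lemma card_joint_link_on:
  assumes fin: "finite Y" "finite Z"
    and disj: "X \<inter> Y = {}" "Y \<inter> Z = {}" "X \<inter> Z = {}"
    and H: "H \<subseteq> cross_triples X Y Z"
    and xs: "xs \<noteq> []" "set xs \<subseteq> X"
  shows "real (card (joint_link_on H (set xs) P))
           = (\<Sum>w\<in>edge_pairs P Y Z. \<Prod>x\<leftarrow>xs. hyperedge H x w)"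
proof -
  let ?S = "{w \<in> edge_pairs P Y Z. \<forall>x\<in>set xs. {x, fst w, snd w} \<in> H}"
  have finE: "finite (edge_pairs P Y Z)"
    by (rule finite_subset[of _ "Y \<times> Z"]) (use fin in \<open>auto simp: edge_pairs_def\<close>)
  \<comment> \<open>The link does not record which endpoint lies in which class; this is recovered
    from disjointness, since \<open>x\<close> already takes the place in \<open>X\<close>.\<close>
  have link: "e \<in> link_edges H x \<Longrightarrow> \<exists>y\<in>Y. \<exists>z\<in>Z. e = {y, z} \<and> {x, y, z} \<in> H"
    if "x \<in> X" for e x
  proof -
    assume "e \<in> link_edges H x"
    then obtain u w where e: "e = {u, w}" "{u, x, w} \<in> H" by (auto simp: link_edges_def)
    then obtain x' y z where xyz: "x' \<in> X" "y \<in> Y" "z \<in> Z" "{u, x, w} = {x', y, z}"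
      using subsetD[OF H e(2)] unfolding cross_triples_def by blast
    have "x = x'"
    proof -
      have "x \<in> {x', y, z}" using xyz(4) by blast
      then show ?thesis using that xyz disj by auto
    qed
    have "y \<noteq> z" "x \<noteq> y" "x \<noteq> z" using that xyz disj by auto
    moreover have "y \<in> {u, x, w}" "z \<in> {u, x, w}" using xyz(4) by auto
    ultimately have "{u, w} = {y, z}" by auto
    moreover from xyz(4) e(2) \<open>x = x'\<close> have "{x, y, z} \<in> H" by simp
    ultimately show ?thesis using e(1) xyz(2,3) by auto
  qed
  have "joint_link_on H (set xs) P = (\<lambda>(y, z). {y, z}) ` ?S"
  proof (intro equalityI subsetI)
    fix e assume "e \<in> joint_link_on H (set xs) P"
    then have e: "e \<in> link_edges H x" "e \<in> P" if "x \<in> set xs" for x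
      using that unfolding joint_link_on_def link_on_def by blast+
    obtain x0 where x0: "x0 \<in> set xs" using xs(1) by (cases xs) auto
    then have "x0 \<in> X" using xs(2) by blast
    from link[OF this e(1)[OF x0]] obtain y z where yz: "y \<in> Y" "z \<in> Z" "e = {y, z}" by blast
    have "{x, y, z} \<in> H" if "x \<in> set xs" for x
    proof -
      have "x \<in> X" using that xs(2) by blast
      from link[OF this e(1)[OF that]] obtain y' z' where "e = {y', z'}" "{x, y', z'} \<in> H" by blast
      then show ?thesis using yz(3) by simp
    qed
    then have "(y, z) \<in> ?S" using yz e(2)[OF x0] by (simp add: edge_pairs_def)
    then show "e \<in> (\<lambda>(y, z). {y, z}) ` ?S" by (rule rev_image_eqI) (simp add: yz(3))
  next
    fix e assume "e \<in> (\<lambda>(y, z). {y, z}) ` ?S"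
    then obtain y z where yz: "e = {y, z}" "{y, z} \<in> P" "\<And>x. x \<in> set xs \<Longrightarrow> {x, y, z} \<in> H"
      by (auto simp: edge_pairs_def)
    have "e \<in> link_edges H x" if "x \<in> set xs" for x
    proof -
      have "{y, x, z} \<in> H" using yz(3)[OF that] by (simp add: insert_commute)
      then show ?thesis unfolding link_edges_def yz(1) by blast
    qed
    then show "e \<in> joint_link_on H (set xs) P"
      using yz(1,2) by (simp add: joint_link_on_def link_on_def)
  qed
  moreover have "inj_on (\<lambda>(y, z). {y, z}) ?S"
    using disj(2) by (auto simp: inj_on_def edge_pairs_def doubleton_eq_iff)
  ultimately have "card (joint_link_on H (set xs) P) = card ?S"
    by (simp add: card_image)
  moreover have "(\<Prod>x\<leftarrow>xs. hyperedge H x w) = of_bool (\<forall>x\<in>set xs. {x, fst w, snd w} \<in> H)" for w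
    by (induction xs) (auto simp: hyperedge_def case_prod_unfold)
  ultimately show ?thesis
    using finE by (simp add: of_bool_def sum.If_cases Int_def)
qed

section \<open>Markov's inequality and the choice of \<open>\<delta>3\<close> and
  \<open>\<delta>2\<close>\<close>

lemma card_mult_le_sum:
  fixes f :: "'b \<Rightarrow> real"
  assumes "finite S" "B \<subseteq> S" "\<And>x. x \<in> S \<Longrightarrow> 0 \<le> f x" "\<And>x. x \<in> B \<Longrightarrow> a \<le> f x"
  shows "real (card B) * a \<le> (\<Sum>x\<in>S. f x)"
proof -
  have "real (card B) * a = (\<Sum>x\<in>B. a)" by simp
  also have "\<dots> \<le> (\<Sum>x\<in>B. f x)" by (rule sum_mono[OF assms(4)])
  also have "\<dots> \<le> (\<Sum>x\<in>S. f x)" using assms by (intro sum_mono2) auto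
  finally show ?thesis .
qed

text \<open>Source of the odd factor in \<open>d2 ^ (2 * t + 1)\<close>: \<open>p ^ t\<close>
  accounts for \<open>2 * t\<close> of them, the number of edges between \<open>Y\<close> and
  \<open>Z\<close> for the last.\<close>

lemma card_edge_pairs_deviation:
  assumes "finite Y" "finite Z" "Y \<inter> Z = {}"
    and "bipartite_regular \<delta> d Y Z (edges_between P Y Z)"
  shows "\<bar>real (card (edge_pairs P Y Z)) - d * card Y * card Z\<bar> \<le> \<delta> * card Y * card Z"
proof -
  have "edge_pairs P Y Z = {w \<in> Y \<times> Z. {fst w, snd w} \<in> P}"
    by (auto simp: edge_pairs_def)
  then have "real (card (edge_pairs P Y Z)) = (\<Sum>y\<in>Y. \<Sum>z\<in>Z. of_bool ({y, z} \<in> P))"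
    using assms(1,2) by (simp only: card_filter_eq_sum_of_bool finite_cartesian_product
      sum.cartesian_product case_prod_unfold)
  then show ?thesis
    using cut_boundedD[OF regular_cut_bounded[OF assms(4,1,2,3)], of Y Z]
    by (simp add: sum_subtractf mult_ac)
qed

theorem proposition1p2:
  "\<forall>t::nat. t \<ge> 2 \<longrightarrow> (\<forall>\<epsilon> d3 :: real. \<epsilon> > 0 \<longrightarrow> d3 > 0 \<longrightarrow>
    (\<exists>\<delta>3 :: real. \<delta>3 > 0 \<and> (\<forall>d2 :: real. d2 > 0 \<longrightarrow>
      (\<exists>(\<delta>2 :: real) (r :: nat). \<delta>2 > 0 \<and> r \<ge> 1 \<and> (\<exists>n0 :: nat.
        \<forall>(X :: 'a set) Y Z EP EH.
          finite X \<longrightarrow> finite Y \<longrightarrow> finite Z \<longrightarrow>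
          card X \<ge> n0 \<longrightarrow> card Y \<ge> n0 \<longrightarrow> card Z \<ge> n0 \<longrightarrow>
          X \<inter> Y = {} \<longrightarrow> Y \<inter> Z = {} \<longrightarrow> X \<inter> Z = {} \<longrightarrow>
          triad \<delta>2 d2 X Y Z EP \<longrightarrow>
          tripartite_hypergraph X Y Z EH \<longrightarrow>
          EH \<subseteq> triangles EP \<longrightarrow>
          hyper_regular \<delta>3 d3 r EH EP \<longrightarrow>
          real (card {xs. length xs = t \<and> set xs \<subseteq> X \<and>
              \<not> \<bar>real (card (joint_link_on EH (set xs) EP))
                   - d3 ^ t * d2 ^ (2 * t + 1) * real (card Y) * real (card Z)\<bar>
                 \<le> \<epsilon> * d3 ^ t * d2 ^ (2 * t + 1) * real (card Y) * real (card Z)})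
            \<le> \<epsilon> * real (card X) ^ t)))))"
proof (intro allI impI)
  fix t :: nat and \<epsilon> d3 :: real
  assume "t \<ge> 2" "\<epsilon> > 0" "d3 > 0"
  \<comment> \<open>Markov's inequality at height \<open>\<epsilon> / 2\<close> for a proportion
    \<open>\<epsilon>\<close> gives \<open>\<epsilon>\<^sup>2 / 2\<close>; the bound
    \<open>?m \<le> 2 * (d2 * N)\<close> costs another 2. The factor \<open>d3 ^ t\<close> appears
    because the counting error is relative to \<open>p ^ t\<close> only.\<close>
  define \<epsilon>' where "\<epsilon>' = \<epsilon>\<^sup>2 * d3 ^ t / 4"
  have "\<epsilon>' > 0" using \<open>\<epsilon> > 0\<close> \<open>d3 > 0\<close> by (simp add: \<epsilon>'_def)
  obtain \<delta>0 where "\<delta>0 > 0" and count: "\<forall>p>0. \<exists>\<kappa>>0. \<forall>(X :: 'a set) (W :: ('a \<times> 'a) set) \<nu> g.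
    relative_bigraph X W \<nu> g p d3 \<kappa> \<delta>0 \<longrightarrow>
      (\<Sum>xs\<in>tuples X t. \<bar>(\<Sum>w\<in>W. \<Prod>x\<leftarrow>xs. g x w) - (d3 * p) ^ t * card W\<bar>)
        \<le> \<epsilon>' * (p ^ t * real (card X) ^ t * card W)"
    using relative_counting[OF \<open>\<epsilon>' > 0\<close> \<open>d3 > 0\<close>, of t] by (elim exE conjE)
  \<comment> \<open>\<open>1 + d3\<close> is the loss in \<open>hyperedge_cut_bounded\<close>, and 2
    comes from bounding the triangle count by twice its expected value.\<close>
  define \<delta>3 where "\<delta>3 = \<delta>0 / (2 * (1 + d3))"
  have "\<delta>3 > 0" using \<open>\<delta>0 > 0\<close> \<open>d3 > 0\<close> by (simp add: \<delta>3_def)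
  show "\<exists>\<delta>3 :: real. \<delta>3 > 0 \<and> (\<forall>d2 :: real. d2 > 0 \<longrightarrow>
      (\<exists>(\<delta>2 :: real) (r :: nat). \<delta>2 > 0 \<and> r \<ge> 1 \<and> (\<exists>n0 :: nat.
        \<forall>(X :: 'a set) Y Z EP EH.
          finite X \<longrightarrow> finite Y \<longrightarrow> finite Z \<longrightarrow>
          card X \<ge> n0 \<longrightarrow> card Y \<ge> n0 \<longrightarrow> card Z \<ge> n0 \<longrightarrow>
          X \<inter> Y = {} \<longrightarrow> Y \<inter> Z = {} \<longrightarrow> X \<inter> Z = {} \<longrightarrow>
          triad \<delta>2 d2 X Y Z EP \<longrightarrow>
          tripartite_hypergraph X Y Z EH \<longrightarrow>
          EH \<subseteq> triangles EP \<longrightarrow>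
          hyper_regular \<delta>3 d3 r EH EP \<longrightarrow>
          real (card {xs. length xs = t \<and> set xs \<subseteq> X \<and>
              \<not> \<bar>real (card (joint_link_on EH (set xs) EP))
                   - d3 ^ t * d2 ^ (2 * t + 1) * real (card Y) * real (card Z)\<bar>
                 \<le> \<epsilon> * d3 ^ t * d2 ^ (2 * t + 1) * real (card Y) * real (card Z)})
            \<le> \<epsilon> * real (card X) ^ t)))"
  proof (rule exI[of _ \<delta>3], intro conjI \<open>\<delta>3 > 0\<close> allI impI)
    fix d2 :: real assume "d2 > 0"
    define p where "p = d2\<^sup>2"
    have "p > 0" using \<open>d2 > 0\<close> by (simp add: p_def)
    obtain \<kappa>0 where "\<kappa>0 > 0" and count': "\<And>(X :: 'a set) (W :: ('a \<times> 'a) set) \<nu> g.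
      relative_bigraph X W \<nu> g p d3 \<kappa>0 \<delta>0 \<Longrightarrow>
      (\<Sum>xs\<in>tuples X t. \<bar>(\<Sum>w\<in>W. \<Prod>x\<leftarrow>xs. g x w) - (d3 * p) ^ t * card W\<bar>)
        \<le> \<epsilon>' * (p ^ t * real (card X) ^ t * card W)"
      using count[rule_format, OF \<open>p > 0\<close>] by (elim exE conjE) (rule that, auto)
    \<comment> \<open>The bound \<open>\<kappa> \<le> p\<close> keeps the number of triangles of
      \<open>P\<close> below \<open>2 * p * ?n * ?m\<close>.\<close>
    define \<kappa> where "\<kappa> = min \<kappa>0 p"
    have "\<kappa> > 0" using \<open>\<kappa>0 > 0\<close> \<open>p > 0\<close> by (simp add: \<kappa>_def)
    \<comment> \<open>The first entry keeps \<open>?m\<close> within a factor 2 of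
      \<open>d2 * N\<close>. The second lets \<open>d2 * N\<close> replace \<open>?m\<close> at half
      the allowed error. The third converts the cherry error, which is relative to \<open>N\<close>,
      into \<open>\<kappa>\<close> relative to \<open>?m\<close>.\<close>
    define \<delta>2 where "\<delta>2 = min (d2 / 2) (min (\<epsilon> * d2 / 2) (\<kappa> * d2 / (2 * (1 + d2))))"
    have "\<delta>2 > 0" using \<open>d2 > 0\<close> \<open>\<epsilon> > 0\<close> \<open>\<kappa> > 0\<close> by (simp add: \<delta>2_def)
    have \<delta>2: "\<delta>2 \<le> d2 / 2" "\<delta>2 \<le> \<epsilon> * d2 / 2" "(1 + d2) * \<delta>2 \<le> \<kappa> * (d2 / 2)"
    proof -
      have "\<delta>2 \<le> \<kappa> * d2 / (2 * (1 + d2))" by (simp add: \<delta>2_def)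
      then show "(1 + d2) * \<delta>2 \<le> \<kappa> * (d2 / 2)"
        using \<open>d2 > 0\<close> by (simp add: pos_le_divide_eq field_simps)
    qed (unfold \<delta>2_def, linarith+)
    show "\<exists>(\<delta>2 :: real) (r :: nat). \<delta>2 > 0 \<and> r \<ge> 1 \<and> (\<exists>n0 :: nat.
        \<forall>(X :: 'a set) Y Z EP EH.
          finite X \<longrightarrow> finite Y \<longrightarrow> finite Z \<longrightarrow>
          card X \<ge> n0 \<longrightarrow> card Y \<ge> n0 \<longrightarrow> card Z \<ge> n0 \<longrightarrow>
          X \<inter> Y = {} \<longrightarrow> Y \<inter> Z = {} \<longrightarrow> X \<inter> Z = {} \<longrightarrow>
          triad \<delta>2 d2 X Y Z EP \<longrightarrow>
          tripartite_hypergraph X Y Z EH \<longrightarrow>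
          EH \<subseteq> triangles EP \<longrightarrow>
          hyper_regular \<delta>3 d3 r EH EP \<longrightarrow>
          real (card {xs. length xs = t \<and> set xs \<subseteq> X \<and>
              \<not> \<bar>real (card (joint_link_on EH (set xs) EP))
                   - d3 ^ t * d2 ^ (2 * t + 1) * real (card Y) * real (card Z)\<bar>
                 \<le> \<epsilon> * d3 ^ t * d2 ^ (2 * t + 1) * real (card Y) * real (card Z)})
            \<le> \<epsilon> * real (card X) ^ t)"
    \<comment> \<open>The first 1 is \<open>r\<close>, the second \<open>n0\<close>. No estimate has
      an additive error term, and tuples with repetitions are averaged with the others, so nonempty
      classes are large enough.\<close>
    proof (rule exI[of _ \<delta>2], rule exI[of _ 1], intro conjI \<open>\<delta>2 > 0\<close> order_refl,
        rule exI[of _ 1], intro allI impI)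
      fix X Y Z :: "'a set" and P H :: "'a set set"
      assume fin: "finite X" "finite Y" "finite Z"
        and ne: "1 \<le> card X" "1 \<le> card Y" "1 \<le> card Z"
        and disj: "X \<inter> Y = {}" "Y \<inter> Z = {}" "X \<inter> Z = {}"
        and triad: "triad \<delta>2 d2 X Y Z P" and H3: "tripartite_hypergraph X Y Z H"
        and HP: "H \<subseteq> triangles P" and reg: "hyper_regular \<delta>3 d3 1 H P"
      let ?W = "edge_pairs P Y Z"
      let ?f = "\<lambda>xs. \<Sum>w\<in>?W. \<Prod>x\<leftarrow>xs. hyperedge H x w"
      let ?n = "real (card X)" and ?m = "real (card ?W)"
      define N where "N = real (card Y) * real (card Z)"
      have "N > 0" using ne by (simp add: N_def)
      have P: "tripartite_graph X Y Z P" using triad by (simp add: triad_def)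
      have "\<bar>?m - d2 * card Y * card Z\<bar> \<le> \<delta>2 * card Y * card Z"
        using triad fin disj by (intro card_edge_pairs_deviation) (auto simp: triad_def)
      then have m: "\<bar>?m - d2 * N\<bar> \<le> \<delta>2 * N" by (simp add: N_def mult.assoc)
      have "\<delta>2 * N \<le> d2 / 2 * N" using \<delta>2(1) \<open>N > 0\<close> by (intro mult_right_mono) auto
      with m have m_lo: "d2 / 2 * N \<le> ?m" and m_hi: "?m \<le> 2 * (d2 * N)"
        using mult_pos_pos[OF \<open>d2 > 0\<close> \<open>N > 0\<close>] by linarith+
      have "cut_bounded X ?W (\<lambda>x w. cherry P x w - p) ((1 + d2) * \<delta>2 * ?n * N)"
        using cherry_cut_bounded[OF fin disj triad] \<open>d2 > 0\<close> by (simp add: p_def N_def)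
      moreover have "(1 + d2) * \<delta>2 * ?n * N \<le> \<kappa> * ?n * ?m"
      proof -
        have "(1 + d2) * \<delta>2 * (?n * N) \<le> \<kappa> * (d2 / 2) * (?n * N)"
          using \<delta>2(3) \<open>N > 0\<close> by (intro mult_right_mono) auto
        also have "\<dots> = \<kappa> * ?n * (d2 / 2 * N)" by simp
        also have "\<dots> \<le> \<kappa> * ?n * ?m" using m_lo \<open>\<kappa> > 0\<close> by (intro mult_left_mono) auto
        finally show ?thesis by (simp add: mult.assoc)
      qed
      ultimately have cut: "cut_bounded X ?W (\<lambda>x w. cherry P x w - p) (\<kappa> * ?n * ?m)"
        by (rule cut_bounded_mono)
      have K: "(\<Sum>x\<in>X. \<Sum>w\<in>?W. cherry P x w) \<le> 2 * p * ?n * ?m"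
      proof -
        have "(\<Sum>x\<in>X. \<Sum>w\<in>?W. cherry P x w) - p * ?n * ?m \<le> \<kappa> * ?n * ?m"
          using cut_boundedD[OF cut order_refl order_refl] by (simp add: sum_subtractf mult_ac)
        moreover have "\<kappa> * ?n * ?m \<le> p * ?n * ?m"
          by (intro mult_right_mono) (auto simp: \<kappa>_def)
        ultimately show ?thesis by linarith
      qed
      have "relative_bigraph X ?W (cherry P) (hyperedge H) p d3 \<kappa>0 \<delta>0"
      proof
        show "finite X" "p > 0" "d3 > 0" by fact+
        show "finite ?W"
          by (rule finite_subset[of _ "Y \<times> Z"]) (use fin in \<open>auto simp: edge_pairs_def\<close>)
        show "X \<noteq> {}" using ne by auto
        show "cut_bounded X ?W (\<lambda>x w. cherry P x w - p) (\<kappa>0 * ?n * ?m)"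
          by (intro cut_bounded_mono[OF cut] mult_right_mono) (auto simp: \<kappa>_def)
        have "(1 + d3) * \<delta>3 = \<delta>0 / 2" using \<open>d3 > 0\<close> by (simp add: \<delta>3_def field_simps)
        then have "(1 + d3) * \<delta>3 * (2 * p * ?n * ?m) = \<delta>0 * p * ?n * ?m" by simp
        with hyperedge_cut_bounded[OF fin disj P HP reg \<open>\<delta>3 > 0\<close> \<open>d3 > 0\<close> K]
        show "cut_bounded X ?W (\<lambda>x w. hyperedge H x w - d3 * cherry P x w) (\<delta>0 * p * ?n * ?m)"
          by simp
        fix x w assume "x \<in> X" "w \<in> ?W"
        show "cherry P x w \<le> 1" by (simp add: cherry_def split: prod.split)
        obtain y z where w: "w = (y, z)" "y \<in> Y" "z \<in> Z"
          using \<open>w \<in> ?W\<close> by (auto simp: edge_pairs_def)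
        then have "x \<noteq> y" "y \<noteq> z" "x \<noteq> z" using \<open>x \<in> X\<close> disj by auto
        then show "0 \<le> hyperedge H x w \<and> hyperedge H x w \<le> cherry P x w"
          using HP triple_in_triangles[of x y z P] by (auto simp: w hyperedge_def cherry_def)
      qed
      then have L1: "(\<Sum>xs\<in>tuples X t. \<bar>?f xs - (d3 * p) ^ t * ?m\<bar>) \<le> \<epsilon>' * (p ^ t * ?n ^ t * ?m)"
        by (rule count')
      let ?M = "d3 ^ t * p ^ t * (d2 * N)"
      have "?M > 0" using \<open>d3 > 0\<close> \<open>p > 0\<close> \<open>d2 > 0\<close> \<open>N > 0\<close> by simp
      define Bad where "Bad = {xs. length xs = t \<and> set xs \<subseteq> X \<and>
              \<not> \<bar>real (card (joint_link_on H (set xs) P))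
                   - d3 ^ t * d2 ^ (2 * t + 1) * real (card Y) * real (card Z)\<bar>
                 \<le> \<epsilon> * d3 ^ t * d2 ^ (2 * t + 1) * real (card Y) * real (card Z)}"
      have "real (card Bad) * (\<epsilon> / 2 * ?M) \<le> (\<Sum>xs\<in>tuples X t. \<bar>?f xs - (d3 * p) ^ t * ?m\<bar>)"
      proof (rule card_mult_le_sum)
        show "Bad \<subseteq> tuples X t" by (auto simp: Bad_def tuples_def)
        fix xs assume "xs \<in> Bad"
        then have xs: "length xs = t" "set xs \<subseteq> X" by (auto simp: Bad_def)
        have f: "real (card (joint_link_on H (set xs) P)) = ?f xs"
          using xs \<open>t \<ge> 2\<close> H3 by (intro card_joint_link_on[OF fin(2,3) disj])
            (auto simp: tripartite_hypergraph_def)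
        have M: "d3 ^ t * d2 ^ (2 * t + 1) * real (card Y) * real (card Z) = ?M"
          "\<epsilon> * d3 ^ t * d2 ^ (2 * t + 1) * real (card Y) * real (card Z) = \<epsilon> * ?M"
        proof -
          have "d2 ^ (2 * t + 1) = p ^ t * d2"
            by (simp only: p_def power_add power_mult power_one_right)
          then show "d3 ^ t * d2 ^ (2 * t + 1) * real (card Y) * real (card Z) = ?M"
            "\<epsilon> * d3 ^ t * d2 ^ (2 * t + 1) * real (card Y) * real (card Z) = \<epsilon> * ?M"
            by (simp_all only: N_def mult_ac)
        qed
        have "\<epsilon> * ?M < \<bar>?f xs - ?M\<bar>"
          using \<open>xs \<in> Bad\<close> unfolding Bad_def mem_Collect_eq f M by linarith
        \<comment> \<open>A bad tuple misses \<open>?M\<close> by more than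
          \<open>\<epsilon> * ?M\<close>; recentring at \<open>(d3 * p) ^ t * ?m\<close> uses up
          half of this and leaves the other half for Markov's inequality.\<close>
        moreover have "\<bar>(d3 * p) ^ t * ?m - ?M\<bar> \<le> \<epsilon> / 2 * ?M"
        proof -
          have "\<bar>(d3 * p) ^ t * ?m - ?M\<bar> = (d3 * p) ^ t * \<bar>?m - d2 * N\<bar>"
            using \<open>d3 > 0\<close> \<open>p > 0\<close>
            by (simp add: power_mult_distrib right_diff_distrib[symmetric] abs_mult)
          also have "\<dots> \<le> (d3 * p) ^ t * (\<epsilon> * d2 / 2 * N)"
            using \<open>d3 > 0\<close> \<open>p > 0\<close> \<open>N > 0\<close>
            by (intro mult_left_mono order.trans[OF m] mult_right_mono \<delta>2(2)) auto
          finally show ?thesis by (simp add: power_mult_distrib mult_ac)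
        qed
        ultimately show "\<epsilon> / 2 * ?M \<le> \<bar>?f xs - (d3 * p) ^ t * ?m\<bar>" by linarith
      qed (use fin in auto)
      also note L1
      also have "\<epsilon>' * (p ^ t * ?n ^ t * ?m) \<le> \<epsilon>' * (p ^ t * ?n ^ t * (2 * (d2 * N)))"
        using m_hi \<open>\<epsilon>' > 0\<close> \<open>p > 0\<close> by (intro mult_left_mono) auto
      also have "\<dots> = (\<epsilon> * ?n ^ t) * (\<epsilon> / 2 * ?M)"
        by (simp add: \<epsilon>'_def power2_eq_square)
      finally have "real (card Bad) \<le> \<epsilon> * ?n ^ t"
        using \<open>?M > 0\<close> \<open>\<epsilon> > 0\<close> by (simp only: mult_le_cancel_right_pos mult_pos_pos half_gt_zero)
      then show "real (card {xs. length xs = t \<and> set xs \<subseteq> X \<and>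
              \<not> \<bar>real (card (joint_link_on H (set xs) P))
                   - d3 ^ t * d2 ^ (2 * t + 1) * real (card Y) * real (card Z)\<bar>
                 \<le> \<epsilon> * d3 ^ t * d2 ^ (2 * t + 1) * real (card Y) * real (card Z)})
            \<le> \<epsilon> * ?n ^ t"
        by (simp only: Bad_def)
    qed
  qed
qed

end
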